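(* There exists a homogeneous harmonic cubic mapping $Q:\mathbb{R}^3\to\mathbb{R}^3$ such that $J_Q(x)\ge0$ for all $x\in\mathbb{R}^3$, while $J_Q\not\equiv0$. Moreover, the zero set of $J_Q$ on the unit sphere $S^2$ is exactly the set of twelve vertices of a regular icosahedron. In particular, $Q$ is not quasiregular.
   Context: A homogeneous harmonic cubic mapping is a map whose components are homogeneous polynomials of degree $3$ that are harmonic with respect to the Euclidean Laplacian; $J_Q=\det DQ$. A nonconstant mapping $f:\Omega\to\mathbb{R}^n$ on a domain $\Omega\subset\mathbb{R}^n$ is (sense-preserving) quasiregular if $f\in W^{1,n}_{\mathrm{loc}}(\Omega,\mathbb{R}^n)$, $J_f\ge0$ a.e., and there is a finite $K$ with $\|Df(x)\|^n\le KJ_f(x)$ for a.e. $x\in\Omega$ (operator norm). *)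

theory Defs
  imports "HOL-Analysis.Analysis"
begin

section \<open>Smoothness and harmonicity of real functions on Euclidean space\<close>

definition partial_deriv :: "'n::finite \<Rightarrow> (real^'n \<Rightarrow> real) \<Rightarrow> real^'n \<Rightarrow> real" where
  "partial_deriv i f x = deriv (\<lambda>t. f (x + t *\<^sub>R axis i 1)) 0"

primrec C_k :: "nat \<Rightarrow> (real^'n::finite \<Rightarrow> real) \<Rightarrow> bool" where
  "C_k 0 f \<longleftrightarrow> continuous_on UNIV f"
| "C_k (Suc k) f \<longleftrightarrow> (\<forall>x. f differentiable (at x)) \<and> (\<forall>i. C_k k (partial_deriv i f))"

definition laplacian :: "(real^'n::finite \<Rightarrow> real) \<Rightarrow> real^'n \<Rightarrow> real" where
  "laplacian f x = (\<Sum>i\<in>UNIV. partial_deriv i (partial_deriv i f) x)"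

definition harmonic :: "(real^'n::finite \<Rightarrow> real) \<Rightarrow> bool" where
  "harmonic f \<longleftrightarrow> C_k 2 f \<and> (\<forall>x. laplacian f x = 0)"

section \<open>Homogeneous harmonic cubic mappings\<close>

text \<open>The sum ranges over the (finitely many) multi-indices of total degree \<open>d\<close>; the zero
  polynomial is homogeneous of every degree.\<close>

definition homogeneous_polynomial :: "nat \<Rightarrow> (real^'n::finite \<Rightarrow> real) \<Rightarrow> bool" where
  "homogeneous_polynomial d f \<longleftrightarrow>
     (\<exists>c :: ('n \<Rightarrow> nat) \<Rightarrow> real. \<forall>x.
        f x = (\<Sum>\<alpha> | (\<Sum>i\<in>UNIV. \<alpha> i) = d. c \<alpha> * (\<Prod>i\<in>UNIV. x $ i ^ \<alpha> i)))"

definition homogeneous_harmonic_cubic :: "(real^'n::finite \<Rightarrow> real^'m::finite) \<Rightarrow> bool" where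
  "homogeneous_harmonic_cubic Q \<longleftrightarrow>
     (\<forall>i. homogeneous_polynomial 3 (\<lambda>x. Q x $ i) \<and> harmonic (\<lambda>x. Q x $ i))"

definition jacobian_det :: "(real^'n::finite \<Rightarrow> real^'n) \<Rightarrow> real^'n \<Rightarrow> real" where
  "jacobian_det Q x = det (jacobian Q (at x))"

section \<open>Regular icosahedra\<close>

text \<open>The icosahedron as a Platonic solid: a three-dimensional convex polytope whose facets are
  congruent equilateral triangles, five of them meeting at each vertex.\<close>

definition regular_icosahedron :: "(real^3) set \<Rightarrow> bool" where
  "regular_icosahedron P \<longleftrightarrow>
     polytope P \<and> aff_dim P = 3 \<and>
     (\<exists>s>0. \<forall>F. F facet_of P \<longrightarrow>
        (\<exists>a b c. F = convex hull {a, b, c} \<and> dist a b = s \<and> dist b c = s \<and> dist c a = s)) \<and>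
     (\<forall>v. v extreme_point_of P \<longrightarrow> card {F. F facet_of P \<and> v \<in> F} = 5)"

section \<open>Local Sobolev spaces and quasiregular mappings\<close>

definition test_function :: "(real^'n::finite) set \<Rightarrow> (real^'n \<Rightarrow> real) \<Rightarrow> bool" where
  "test_function \<Omega> \<phi> \<longleftrightarrow>
     (\<forall>k. C_k k \<phi>) \<and> compact (closure {x. \<phi> x \<noteq> 0}) \<and> closure {x. \<phi> x \<noteq> 0} \<subseteq> \<Omega>"

definition locally_Lp :: "real \<Rightarrow> (real^'n::finite) set \<Rightarrow> (real^'n \<Rightarrow> 'b::euclidean_space) \<Rightarrow> bool" where
  "locally_Lp p \<Omega> f \<longleftrightarrow>
     f \<in> borel_measurable (lebesgue_on \<Omega>) \<and>
     (\<forall>C. compact C \<and> C \<subseteq> \<Omega> \<longrightarrow> set_integrable lebesgue C (\<lambda>x. norm (f x) powr p))"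

text \<open>\<open>G x $ i $ j\<close> is the weak derivative of the \<open>i\<close>-th component of \<open>f\<close> in direction \<open>j\<close>,
  the same row and column convention as in \<^const>\<open>jacobian\<close>.\<close>

definition weak_derivative ::
    "(real^'n::finite) set \<Rightarrow> (real^'n \<Rightarrow> real^'m::finite) \<Rightarrow> (real^'n \<Rightarrow> real^'n^'m) \<Rightarrow> bool" where
  "weak_derivative \<Omega> f G \<longleftrightarrow>
     (\<forall>\<phi>. test_function \<Omega> \<phi> \<longrightarrow>
        (\<forall>i j. (LINT x:\<Omega>|lebesgue. f x $ i * partial_deriv j \<phi> x) =
               - (LINT x:\<Omega>|lebesgue. G x $ i $ j * \<phi> x)))"

text \<open>\<open>f\<close> lies in the local Sobolev space of exponent \<open>p\<close> over \<open>\<Omega>\<close>, with weak derivative \<open>G\<close>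
  (for \<open>p \<ge> 1\<close>, where \<open>G\<close> is unique up to null sets).\<close>

definition sobolev_W1_loc ::
    "real \<Rightarrow> (real^'n::finite) set \<Rightarrow> (real^'n \<Rightarrow> real^'m::finite) \<Rightarrow> (real^'n \<Rightarrow> real^'n^'m) \<Rightarrow> bool" where
  "sobolev_W1_loc p \<Omega> f G \<longleftrightarrow> locally_Lp p \<Omega> f \<and> locally_Lp p \<Omega> G \<and> weak_derivative \<Omega> f G"

definition quasiregular :: "(real^'n::finite) set \<Rightarrow> (real^'n \<Rightarrow> real^'n) \<Rightarrow> bool" where
  "quasiregular \<Omega> f \<longleftrightarrow>
     open \<Omega> \<and> connected \<Omega> \<and> \<Omega> \<noteq> {} \<and> \<not> f constant_on \<Omega> \<and>
     (\<exists>G. sobolev_W1_loc (real CARD('n)) \<Omega> f G \<and>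
          (AE x in lebesgue_on \<Omega>. det (G x) \<ge> 0) \<and>
          (\<exists>K::real. AE x in lebesgue_on \<Omega>. onorm ((*v) (G x)) ^ CARD('n) \<le> K * det (G x)))"

end

theory Submission
  imports Defs "HOL-Computational_Algebra.Polynomial"
begin

text \<open>The components of \<open>Q\<close> are \<open>x (golden\<^sup>2 y\<^sup>2 - golden/3 x\<^sup>2 - z\<^sup>2)\<close> and its cyclic shifts. They
  span the copy inside the harmonic cubics of the three-dimensional irreducible representation of
  the icosahedral group that is Galois conjugate to the standard one. At a vertex the rotation of
  order five acts with weights \<open>\<plusminus>1\<close> on the tangent plane and \<open>0, \<plusminus>2\<close> on the target, so \<open>DQ\<close> has rank one
  there. The Jacobian determinant is a combination of nonnegative terms
  \<open>x\<^sup>2 L\<^sup>2\<close> and \<open>x\<^sup>2 y\<^sup>2 z\<^sup>2\<close>, whose common zeros on the sphere are the vertices.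

  A weak derivative of \<open>Q\<close> agrees almost everywhere with \<open>DQ\<close>, so the distortion inequality would
  hold at every point by continuity; but at a vertex \<open>DQ\<close> is nonzero and \<open>J\<^sub>Q = 0\<close>.

  The facets of the convex hull of the twelve vertices are the triples of vertices with pairwise inner
  product \<open>1 / sqrt 5\<close>: an obtuse pair cannot lie in a facet, and equiangular vectors are linearly
  independent, so a facet has exactly three vertices.\<close>

section \<open>Smooth functions and bumps\<close>

lemma partial_deriv_has_derivative:
  assumes "(f has_derivative D) (at x)"
  shows "partial_deriv i f x = D (axis i 1)"
proof -
  interpret bounded_linear D using assms by (rule has_derivative_bounded_linear)
  have "((\<lambda>t. f (x + t *\<^sub>R axis i 1)) has_derivative (\<lambda>t. D (t *\<^sub>R axis i 1))) (at 0)"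
    by (rule has_derivative_compose[where f="\<lambda>t. x + t *\<^sub>R axis i 1" and g=f])
       (auto intro!: derivative_eq_intros simp: assms)
  then have "((\<lambda>t. f (x + t *\<^sub>R axis i 1)) has_real_derivative D (axis i 1)) (at 0)"
    by (simp add: has_field_derivative_def scaleR mult_commute_abs)
  then show ?thesis by (simp add: partial_deriv_def DERIV_imp_deriv)
qed

lemma has_real_derivative_along_axis:
  assumes "f differentiable (at (x + t *\<^sub>R axis i 1))"
  shows "((\<lambda>t. f (x + t *\<^sub>R axis i 1)) has_real_derivative partial_deriv i f (x + t *\<^sub>R axis i 1)) (at t)"
proof -
  obtain D where D: "(f has_derivative D) (at (x + t *\<^sub>R axis i 1))"
    using assms by (auto simp: differentiable_def)
  interpret bounded_linear D using D by (rule has_derivative_bounded_linear)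
  have "((\<lambda>t. f (x + t *\<^sub>R axis i 1)) has_derivative (\<lambda>h. D (h *\<^sub>R axis i 1))) (at t)"
    by (rule has_derivative_compose[where f="\<lambda>t. x + t *\<^sub>R axis i 1" and g=f])
       (auto intro!: derivative_eq_intros simp: D)
  then show ?thesis
    by (simp add: has_field_derivative_def scaleR mult_commute_abs partial_deriv_has_derivative[OF D])
qed

lemma partial_deriv_const [simp]: "partial_deriv i (\<lambda>x. c) = (\<lambda>x. 0)"
  by (simp add: partial_deriv_def fun_eq_iff)

lemma partial_deriv_nth: "partial_deriv j (\<lambda>x. x $ i) = (\<lambda>x. if i = j then 1 else 0)"
proof
  fix x :: "real^'a"
  have "((\<lambda>x. x $ i) has_derivative (\<lambda>h. h $ i)) (at x)"
    by (rule bounded_linear_imp_has_derivative) (rule bounded_linear_vec_nth)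
  from partial_deriv_has_derivative[OF this]
  show "partial_deriv j (\<lambda>x. x $ i) x = (if i = j then 1 else 0)"
    by (simp add: axis_def)
qed

lemma partial_deriv_add:
  assumes "\<And>x. f differentiable (at x)" "\<And>x. g differentiable (at x)"
  shows "partial_deriv i (\<lambda>x. f x + g x) = (\<lambda>x. partial_deriv i f x + partial_deriv i g x)"
proof
  fix x
  obtain D E where D: "(f has_derivative D) (at x)" and E: "(g has_derivative E) (at x)"
    using assms by (meson differentiable_def)
  show "partial_deriv i (\<lambda>x. f x + g x) x = partial_deriv i f x + partial_deriv i g x"
    using partial_deriv_has_derivative[OF has_derivative_add[OF D E]]
    by (simp add: partial_deriv_has_derivative[OF D] partial_deriv_has_derivative[OF E])
qed

lemma partial_deriv_mult:
  assumes "\<And>x. f differentiable (at x)" "\<And>x. g differentiable (at x)"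
  shows "partial_deriv i (\<lambda>x. f x * g x) = (\<lambda>x. f x * partial_deriv i g x + partial_deriv i f x * g x)"
proof
  fix x
  obtain D E where D: "(f has_derivative D) (at x)" and E: "(g has_derivative E) (at x)"
    using assms by (meson differentiable_def)
  show "partial_deriv i (\<lambda>x. f x * g x) x = f x * partial_deriv i g x + partial_deriv i f x * g x"
    using partial_deriv_has_derivative[OF has_derivative_mult[OF D E]]
    by (simp add: partial_deriv_has_derivative[OF D] partial_deriv_has_derivative[OF E])
qed

section \<open>Closure properties of the classes \<open>C_k\<close>\<close>

lemma C_k_imp_continuous: "C_k k f \<Longrightarrow> continuous_on UNIV f"
  by (cases k) (auto intro!: continuous_at_imp_continuous_on differentiable_imp_continuous_within)

lemma C_k_Suc_imp: "C_k (Suc k) f \<Longrightarrow> C_k k f"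
proof (induction k arbitrary: f)
  case 0
  then show ?case using C_k_imp_continuous C_k.simps(1) by blast
qed simp

lemma C_k_const: "C_k k (\<lambda>x. c)"
  by (induction k arbitrary: c) simp_all

lemma C_k_nth: "C_k k (\<lambda>x. x $ i)"
proof (cases k)
  case (Suc n)
  have "(\<lambda>x::real^'a. x $ i) differentiable (at x)" for x
    by (intro bounded_linear_imp_differentiable bounded_linear_vec_nth)
  then show ?thesis by (simp add: Suc partial_deriv_nth C_k_const)
qed (simp add: continuous_intros)

lemma C_k_add: "C_k k f \<Longrightarrow> C_k k g \<Longrightarrow> C_k k (\<lambda>x. f x + g x)"
  by (induction k arbitrary: f g) (auto simp: partial_deriv_add intro: continuous_on_add)

lemma C_k_mult: "C_k k f \<Longrightarrow> C_k k g \<Longrightarrow> C_k k (\<lambda>x. f x * g x)"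
proof (induction k arbitrary: f g)
  case (Suc k)
  then have "C_k k f" "C_k k g" by (simp_all only: C_k_Suc_imp)
  with Suc show ?case
    by (auto simp: partial_deriv_mult intro!: C_k_add)
qed (auto intro: continuous_on_mult)

lemma C_k_prod: "finite A \<Longrightarrow> (\<And>i. i \<in> A \<Longrightarrow> C_k k (f i)) \<Longrightarrow> C_k k (\<lambda>x. \<Prod>i\<in>A. f i x)"
  by (induction A rule: finite_induct) (auto intro: C_k_const C_k_mult)

section \<open>Flat functions and smooth bumps\<close>

lemma C_k_compose_affine_nth:
  fixes g :: "nat \<Rightarrow> real \<Rightarrow> real"
  assumes g: "\<And>n t. (g n has_real_derivative g (Suc n) t) (at t)"
  shows "C_k k (\<lambda>x::real^'n::finite. g n (\<alpha> * x $ i + \<beta>))"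
proof (induction k arbitrary: n)
  case 0
  have "continuous_on UNIV (g n)"
    using g by (blast intro: continuous_at_imp_continuous_on DERIV_isCont)
  then show ?case
    by (auto intro!: continuous_on_compose2[of UNIV "g n"] continuous_intros)
next
  case (Suc k)
  have D: "((\<lambda>x::real^'n. g n (\<alpha> * x $ i + \<beta>)) has_derivative
      (\<lambda>h. \<alpha> * h $ i * g (Suc n) (\<alpha> * x $ i + \<beta>))) (at x)" for x
  proof -
    have "((\<lambda>x::real^'n. \<alpha> * x $ i + \<beta>) has_derivative (\<lambda>h. \<alpha> * h $ i)) (at x)"
      by (auto intro!: derivative_eq_intros bounded_linear_imp_has_derivative bounded_linear_vec_nth)
    from has_derivative_compose[OF this g[unfolded has_field_derivative_def]]
    show ?thesis by (simp add: mult.commute)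
  qed
  \<comment> \<open>The functions \<open>g n\<close> list successive derivatives, so a partial
    derivative is a constant times the next member of the family. This is why the induction keeps
    \<open>n\<close> arbitrary.\<close>
  have "partial_deriv j (\<lambda>x::real^'n. g n (\<alpha> * x $ i + \<beta>)) =
      (\<lambda>x. (if i = j then \<alpha> else 0) * g (Suc n) (\<alpha> * x $ i + \<beta>))" for j
    by (simp add: fun_eq_iff partial_deriv_has_derivative[OF D] axis_def)
  with Suc D show ?case
    by (auto simp: differentiable_def intro!: C_k_mult C_k_const)
qed

text \<open>All derivatives of \<open>exp (- 1/t)\<close>, extended by zero to \<open>t \<le> 0\<close>, have this shape.\<close>

definition flat :: "real poly \<Rightarrow> real \<Rightarrow> real" where
  "flat p t = (if t > 0 then poly p (1 / t) * exp (- 1 / t) else 0)"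

text \<open>With s = 1/t, differentiating p(s) exp(-s) in t gives s^2 (p(s) - p'(s)) exp(-s),
  because ds/dt = -s^2.\<close>

definition flat_deriv :: "real poly \<Rightarrow> real poly" where
  "flat_deriv p = [:0, 0, 1:] * (p - pderiv p)"

text \<open>Substituting s = 1/t turns the limit from the right into that of a polynomial times
  exp(-s) at infinity. From the left the function is identically zero.\<close>

lemma flat_tendsto_0: "(flat p \<longlongrightarrow> 0) (at 0)"
proof -
  have "((\<lambda>s. \<Sum>i\<le>degree p. coeff p i * (s ^ i / exp s)) \<longlongrightarrow> (\<Sum>i\<le>degree p. coeff p i * 0)) at_top"
    by (intro tendsto_intros tendsto_power_div_exp_0)
  then have "((\<lambda>s. poly p s * exp (- s)) \<longlongrightarrow> 0) at_top"
    by (simp add: poly_altdef sum_distrib_right exp_minus divide_inverse mult.assoc)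
  then have "((\<lambda>t. poly p (inverse t) * exp (- inverse t)) \<longlongrightarrow> 0) (at_right 0)"
    by (rule filterlim_compose) (rule filterlim_inverse_at_top_right)
  then have "(flat p \<longlongrightarrow> 0) (at_right 0)"
    by (rule Lim_transform_eventually)
       (auto simp: flat_def eventually_at_filter divide_inverse)
  moreover have "(flat p \<longlongrightarrow> 0) (at_left 0)"
    by (rule Lim_transform_eventually[OF tendsto_const])
       (auto simp: flat_def eventually_at_filter)
  ultimately show ?thesis by (simp add: filterlim_split_at)
qed

lemma DERIV_flat: "(flat p has_real_derivative flat (flat_deriv p) t) (at t)"
proof (cases t "0::real" rule: linorder_cases)
  case less
  have "((\<lambda>t. 0) has_real_derivative flat (flat_deriv p) t) (at t)"
    using less by (simp add: flat_def)
  then show ?thesis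
    by (rule has_field_derivative_transform_within_open[of _ _ _ "{..<0}"])
       (use less in \<open>auto simp: flat_def\<close>)
next
  case equal
  \<comment> \<open>The difference quotient at 0 is itself a flat function, with the polynomial
    multiplied by its variable, so it tends to 0.\<close>
  have "flat p h / h = flat ([:0, 1:] * p) h" for h
    by (simp add: flat_def)
  then show ?thesis
    using flat_tendsto_0[of "[:0, 1:] * p"]
    by (simp add: equal has_field_derivative_iff flat_def[of _ 0])
next
  case greater
  have inv: "((\<lambda>t. 1 / t) has_real_derivative - (1 / t\<^sup>2)) (at t)"
    using greater by (auto intro!: derivative_eq_intros simp: power2_eq_square)
  have "((\<lambda>t. poly p (1 / t) * exp (- (1 / t))) has_real_derivative
      poly (pderiv p) (1 / t) * - (1 / t\<^sup>2) * exp (- (1 / t))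
      + exp (- (1 / t)) * - (- (1 / t\<^sup>2)) * poly p (1 / t)) (at t)"
    by (intro DERIV_mult DERIV_chain2[OF poly_DERIV inv] DERIV_chain2[OF DERIV_exp DERIV_minus[OF inv]])
  also have "poly (pderiv p) (1 / t) * - (1 / t\<^sup>2) * exp (- (1 / t))
      + exp (- (1 / t)) * - (- (1 / t\<^sup>2)) * poly p (1 / t) = flat (flat_deriv p) t"
    using greater by (simp add: flat_def flat_deriv_def power2_eq_square algebra_simps)
  finally have "((\<lambda>t. poly p (1 / t) * exp (- 1 / t)) has_real_derivative flat (flat_deriv p) t) (at t)"
    by simp
  then show ?thesis
    by (rule has_field_derivative_transform_within_open[of _ _ _ "{0<..}"])
       (use greater in \<open>auto simp: flat_def\<close>)
qed

lemma C_k_flat: "C_k k (\<lambda>x::real^'n::finite. flat 1 (\<alpha> * x $ i + \<beta>))"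
  using C_k_compose_affine_nth[of "\<lambda>n. flat ((flat_deriv ^^ n) 1)" k 0 \<alpha> i \<beta>]
  by (simp add: DERIV_flat)

text \<open>The parameter \<open>k\<close> scales the distances d to the faces of the box, and
  exp(-1/(k d)) tends to 1 for d > 0; thus the bumps approximate the indicator of the open box. The
  arguments are written in the affine form that \<open>C_k_flat\<close> expects.\<close>

definition bump :: "real^'n::finite \<Rightarrow> real^'n \<Rightarrow> nat \<Rightarrow> real^'n \<Rightarrow> real" where
  "bump a b k x = (\<Prod>i\<in>UNIV. flat 1 (k * x $ i + - k * a $ i) * flat 1 (- k * x $ i + k * b $ i))"

lemma bump_nonneg: "0 \<le> bump a b k x"
  by (auto simp: bump_def flat_def intro!: prod_nonneg)

lemma bump_le_1: "bump a b k x \<le> 1"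
  by (auto simp: bump_def flat_def intro!: prod_le_1 mult_le_one)

lemma bump_eq_0: "x \<notin> box a b \<Longrightarrow> bump a b k x = 0"
proof -
  assume "x \<notin> box a b"
  then obtain i where "x $ i \<le> a $ i \<or> b $ i \<le> x $ i" by (auto simp: mem_box_cart not_less)
  then have "k * x $ i + - k * a $ i \<le> 0 \<or> - k * x $ i + k * b $ i \<le> 0"
    by (auto simp: mult_left_mono)
  then have "flat 1 (k * x $ i + - k * a $ i) * flat 1 (- k * x $ i + k * b $ i) = 0"
    by (auto simp only: flat_def mult_eq_0_iff not_less[symmetric] if_False)
  then show ?thesis unfolding bump_def by (intro prod_zero) auto
qed

lemma bump_tendsto_indicator: "(\<lambda>k. bump a b k x) \<longlonglongrightarrow> indicator (box a b) x"
proof (cases "x \<in> box a b")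
  case True
  have lim: "(\<lambda>k. flat 1 (real k * d)) \<longlonglongrightarrow> 1" if "d > 0" for d
  proof -
    have "(\<lambda>k. exp (- (inverse (real k) * inverse d))) \<longlonglongrightarrow> exp (- (0 * inverse d))"
      by (intro tendsto_intros lim_inverse_n)
    then have *: "(\<lambda>k. exp (- (inverse (real k) * inverse d))) \<longlonglongrightarrow> 1" by simp
    show ?thesis
      by (rule Lim_transform_eventually[OF *])
         (use that in \<open>auto simp: flat_def divide_inverse intro!: eventually_sequentiallyI[of 1]\<close>)
  qed
  have "(\<lambda>k. \<Prod>i\<in>UNIV. flat 1 (real k * (x $ i - a $ i)) * flat 1 (real k * (b $ i - x $ i)))
      \<longlonglongrightarrow> (\<Prod>i\<in>(UNIV::'a set). 1 * 1)"
    using True by (intro tendsto_prod tendsto_mult lim) (auto simp: mem_box_cart)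
  then show ?thesis using True by (simp add: bump_def algebra_simps)
qed (simp add: bump_eq_0)

lemma test_function_bump: "test_function UNIV (bump a b k)"
proof -
  have "{x. bump a b k x \<noteq> 0} \<subseteq> cbox a b"
    using bump_eq_0 box_subset_cbox by blast
  then have "compact (closure {x. bump a b k x \<noteq> 0})"
    by (simp add: bounded_subset[OF bounded_cbox])
  moreover have "C_k m (bump a b k)" for m
    unfolding bump_def by (intro C_k_prod C_k_mult C_k_flat) simp
  ultimately show ?thesis by (simp add: test_function_def)
qed

section \<open>Weak derivatives of smooth maps\<close>

text \<open>Open boxes are stable under intersection and generate the Borel sets, so vanishing of
  the integral spreads from boxes to Borel and then Lebesgue sets. An integrable density with all
  integrals zero vanishes almost everywhere.\<close>

lemma AE_zero_if_box_integrals_zero: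
  fixes h :: "'a::euclidean_space \<Rightarrow> real"
  assumes int: "\<And>a b. set_integrable lebesgue (box a b) h"
    and zero: "\<And>a b. (LINT x:box a b|lebesgue. h x) = 0"
  shows "AE x in lebesgue. h x = 0"
proof -
  have "AE x in lebesgue. x \<in> box c d \<longrightarrow> h x = 0" for c d :: 'a
  proof -
    \<comment> \<open>Cutting off at a fixed box makes the function integrable on the whole space,
      which the complement step of the induction requires. Countably many boxes are put together at
      the end.\<close>
    define g where "g = (\<lambda>x. indicator (box c d) x *\<^sub>R h x)"
    have g: "integrable lebesgue g" using int[of c d] by (simp add: g_def set_integrable_def)
    have gi: "set_integrable lebesgue A g" if "A \<in> sets lebesgue" for A
      unfolding set_integrable_def using g that by (rule integrable_mult_indicator[rotated])
    have box: "(LINT x:box a b|lebesgue. g x) = 0" for a b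
    proof -
      obtain p q where "box a b \<inter> box c d = box p q" by (rule that[OF box_Int_box])
      then have "indicator (box p q) x = (indicator (box a b) x * indicator (box c d) x :: real)" for x
        by (simp flip: indicator_inter_arith)
      then show ?thesis using zero[of p q]
        by (simp add: g_def set_lebesgue_integral_def mult.assoc)
    qed
    have total: "(LINT x|lebesgue. g x) = 0"
      using zero[of c d] by (simp add: g_def set_lebesgue_integral_def)
    have borel: "(LINT x:A|lebesgue. g x) = 0" if "A \<in> sets borel" for A
    proof -
      have "Int_stable (range (\<lambda>(a, b). box a b :: 'a set))"
        by (auto simp: Int_stable_def box_Int_box)
      moreover have "(range (\<lambda>(a, b). box a b)) \<subseteq> Pow UNIV" by auto
      moreover have "A \<in> sigma_sets UNIV (range (\<lambda>(a, b). box a b))"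
        using that unfolding borel_eq_box by simp
      ultimately show ?thesis
      proof (induction rule: sigma_sets_induct_disjoint)
        case (basic A) then show ?case by (auto simp: box)
      next
        case empty then show ?case by (simp add: set_lebesgue_integral_def)
      next
        case (compl A)
        then have A: "A \<in> sets lebesgue" by (simp add: borel_eq_box)
        have "(LINT x:A \<union> (UNIV - A)|lebesgue. g x)
            = (LINT x:A|lebesgue. g x) + (LINT x:(UNIV - A)|lebesgue. g x)"
          using A by (intro set_integral_Un gi) auto
        then show ?case using compl total by (simp add: set_lebesgue_integral_def)
      next
        case (union F)
        then have "F i \<in> sets borel" for i by (simp add: borel_eq_box subset_eq)
        then have F: "F i \<in> sets lebesgue" for i by simp
        have "(LINT x:(\<Union>i. F i)|lebesgue. g x) = (\<Sum>i. LINT x:F i|lebesgue. g x)"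
          using union F by (intro lebesgue_integral_countable_add gi sets.countable_UN)
             (auto simp: disjoint_family_on_def)
        then show ?case using union by simp
      qed
    qed
    have "AE x in lebesgue. g x = 0"
    proof (rule density_unique_real[OF g integrable_zero])
      fix A :: "'a set" assume A: "A \<in> sets lebesgue"
      \<comment> \<open>A Lebesgue set differs from a Borel set by a null set, so the Borel case
        suffices.\<close>
      then obtain S N N' where S: "A = S \<union> N" "N \<subseteq> N'" "N' \<in> null_sets lborel" "S \<in> sets lborel"
        by (rule sets_completionE)
      have "N' \<in> null_sets lebesgue" using S(3) by (simp add: null_sets_completionI)
      then have "AE x in lebesgue. x \<in> S \<longleftrightarrow> x \<in> A"
        using S by (auto dest!: AE_not_in)
      moreover have "set_borel_measurable lebesgue S g" "set_borel_measurable lebesgue A g"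
        using gi[of S] gi[of A] S A by (auto simp: set_integrable_def set_borel_measurable_def
          intro!: borel_measurable_integrable)
      ultimately have "(LINT x:A|lebesgue. g x) = (LINT x:S|lebesgue. g x)"
        by (intro set_integral_cong_set)
      then show "(LINT x:A|lebesgue. g x) = (LINT x:A|lebesgue. 0)"
        using borel S by (simp add: set_lebesgue_integral_def)
    qed
    then show ?thesis by eventually_elim (auto simp: g_def indicator_def split: if_splits)
  qed
  then have "AE x in lebesgue. \<forall>n::nat. x \<in> box (- real n *\<^sub>R One) (real n *\<^sub>R One) \<longrightarrow> h x = 0"
    unfolding AE_all_countable by blast
  then show ?thesis
  proof eventually_elim
    case (elim x)
    have "x \<in> (\<Union>n::nat. box (- real n *\<^sub>R One) (real n *\<^sub>R One))"
      using UN_box_eq_UNIV by auto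
    with elim show ?case by blast
  qed
qed

section \<open>Integration by parts against test functions\<close>

lemma partial_deriv_eq_0_outside_support:
  assumes "x \<notin> closure {x. u x \<noteq> 0}"
  shows "partial_deriv i u x = 0"
proof -
  have "((\<lambda>x. 0) has_derivative (\<lambda>h. 0)) (at x)" by simp
  then have "(u has_derivative (\<lambda>h. 0)) (at x)"
  proof (rule has_derivative_transform_within_open)
    show "open (- closure {x. u x \<noteq> 0})" by (intro open_Compl closed_closure)
    show "x \<in> - closure {x. u x \<noteq> 0}" using assms by blast
    show "0 = u y" if "y \<in> - closure {x. u x \<noteq> 0}" for y
    proof (rule ccontr)
      assume "0 \<noteq> u y"
      then have "y \<in> {x. u x \<noteq> 0}" by simp
      with that closure_subset[of "{x. u x \<noteq> 0}"] show False by blast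
    qed
  qed
  then show ?thesis by (simp add: partial_deriv_has_derivative)
qed

lemma integrable_continuous_compact_support:
  fixes u :: "'a::euclidean_space \<Rightarrow> real"
  assumes "continuous_on UNIV u" "compact K" "\<And>x. x \<notin> K \<Longrightarrow> u x = 0"
  shows "integrable lborel u"
proof -
  have "integrable lborel (\<lambda>x. indicator K x *\<^sub>R u x)"
    using assms by (intro borel_integrable_compact) (auto intro: continuous_on_subset)
  also have "(\<lambda>x. indicator K x *\<^sub>R u x) = u"
    using assms(3) by (auto simp: indicator_def fun_eq_iff)
  finally show ?thesis .
qed

text \<open>Translation invariance makes the integral of every difference quotient zero. The
  quotients converge to the partial derivative and are dominated, by the mean value theorem and the
  compact support, so the limit has integral zero too.\<close>

lemma integral_partial_deriv_eq_0:
  fixes u :: "real^'n::finite \<Rightarrow> real"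
  assumes diff: "\<And>x. u differentiable (at x)"
    and cont: "continuous_on UNIV (partial_deriv j u)"
    and supp: "compact (closure {x. u x \<noteq> 0})"
  shows "(LINT x|lborel. partial_deriv j u x) = 0"
proof -
  define S where "S = closure {x. u x \<noteq> 0}"
  define e :: "real^'n" where "e = axis j 1"
  define q where "q n x = (u (x + inverse (real (Suc n)) *\<^sub>R e) - u x) * real (Suc n)" for n x
  have norm_e: "norm e = 1" by (simp add: e_def)
  have u0: "u x = 0" if "x \<notin> S" for x
    using that closure_subset[of "{x. u x \<noteq> 0}"] by (auto simp: S_def)
  have d0: "partial_deriv j u x = 0" if "x \<notin> S" for x
    using that by (simp add: S_def partial_deriv_eq_0_outside_support)
  have cu: "continuous_on UNIV u"
    using diff by (intro continuous_at_imp_continuous_on ballI differentiable_imp_continuous_within)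
  have iu: "integrable lborel u"
    using integrable_continuous_compact_support[OF cu supp[folded S_def] u0] .
  have [measurable]: "u \<in> borel_measurable borel" "partial_deriv j u \<in> borel_measurable borel"
    using cu cont by (auto intro: borel_measurable_continuous_onI)
  have shift: "integrable lborel (\<lambda>x. u (x + c)) \<and> (LINT x|lborel. u (x + c)) = (LINT x|lborel. u x)" for c
  proof -
    have "integrable (distr lborel borel ((+) c)) u" unfolding lborel_distr_plus by (rule iu)
    then have "integrable lborel (\<lambda>x. u (c + x))" by (subst (asm) integrable_distr_eq) auto
    moreover have "(LINT x|lborel. u (c + x)) = (LINT x|distr lborel borel ((+) c). u x)"
      by (subst integral_distr) auto
    ultimately show ?thesis by (simp add: lborel_distr_plus add.commute)
  qed
  have int_q: "(LINT x|lborel. q n x) = 0" for n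
    using shift[of "inverse (real (Suc n)) *\<^sub>R e"] iu by (simp add: q_def)
  obtain R where "\<forall>x\<in>S. norm x \<le> R"
    using compact_imp_bounded[OF supp] unfolding bounded_iff S_def by blast
  then have R: "S \<subseteq> cball 0 R" by auto
  have "bounded (partial_deriv j u ` S)"
    using supp cont by (intro compact_imp_bounded compact_continuous_image)
      (auto simp: S_def intro: continuous_on_subset)
  then obtain M where M: "\<And>x. x \<in> S \<Longrightarrow> \<bar>partial_deriv j u x\<bar> \<le> M" "M > 0"
    by (auto simp: bounded_pos)
  have M': "\<bar>partial_deriv j u x\<bar> \<le> M" for x
    using M d0 by (cases "x \<in> S") auto
  have q_MVT: "\<exists>\<xi>. q n x = partial_deriv j u \<xi>" for n x
  proof -
    have "\<exists>z. 0 < z \<and> z < inverse (real (Suc n)) \<and>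
      u (x + inverse (real (Suc n)) *\<^sub>R e) - u (x + 0 *\<^sub>R e)
       = (inverse (real (Suc n)) - 0) * partial_deriv j u (x + z *\<^sub>R e)"
      using diff unfolding e_def by (intro MVT2 has_real_derivative_along_axis) auto
    then show ?thesis by (auto simp: q_def field_simps)
  qed
  \<comment> \<open>The increments have length at most 1, so for \<open>x\<close> outside the ball
    of radius \<open>R + 1\<close> both evaluation points miss the support.\<close>
  have bound: "norm (q n x) \<le> M * indicator (cball 0 (R + 1)) x" for n x
  proof (cases "x \<in> cball 0 (R + 1)")
    case True
    then show ?thesis using q_MVT[of n x] M' by auto
  next
    case False
    have "norm x \<le> norm (x + inverse (real (Suc n)) *\<^sub>R e) + norm (inverse (real (Suc n)) *\<^sub>R e)"
      by (metis add_diff_cancel norm_triangle_ineq4)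
    also have "norm (inverse (real (Suc n)) *\<^sub>R e) \<le> 1" using norm_e by (simp add: field_simps)
    finally have "x \<notin> S" "x + inverse (real (Suc n)) *\<^sub>R e \<notin> S" using R False by auto
    then show ?thesis using M(2) by (simp add: q_def u0)
  qed
  have lim: "(\<lambda>n. q n x) \<longlonglongrightarrow> partial_deriv j u x" for x
  proof -
    have "((\<lambda>t. u (x + t *\<^sub>R e)) has_real_derivative partial_deriv j u x) (at 0)"
      using has_real_derivative_along_axis[of u x 0 j] diff by (simp add: e_def)
    then have "((\<lambda>h. (u (x + h *\<^sub>R e) - u x) / h) \<longlongrightarrow> partial_deriv j u x) (at 0)"
      by (simp add: has_field_derivative_iff)
    moreover have "filterlim (\<lambda>n. inverse (real (Suc n))) (at 0) sequentially"
      by (auto simp: filterlim_at LIMSEQ_inverse_real_of_nat simp del: of_nat_Suc)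
    ultimately have "(\<lambda>n. (u (x + inverse (real (Suc n)) *\<^sub>R e) - u x) / inverse (real (Suc n)))
        \<longlonglongrightarrow> partial_deriv j u x" by (rule filterlim_compose)
    then show ?thesis by (simp add: q_def divide_inverse)
  qed
  have "(\<lambda>n. LINT x|lborel. q n x) \<longlonglongrightarrow> (LINT x|lborel. partial_deriv j u x)"
  proof (rule integral_dominated_convergence[where w="\<lambda>x. M * indicator (cball 0 (R + 1)) x"])
    show "integrable lborel (\<lambda>x::real^'n. M * indicator (cball 0 (R + 1)) x)"
      by (intro integrable_mult_right integrable_real_indicator) (use emeasure_bounded_finite[OF bounded_cball] in \<open>auto simp: top.not_eq_extremum\<close>)
    show "AE x in lborel. (\<lambda>n. q n x) \<longlonglongrightarrow> partial_deriv j u x" using lim by simp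
    show "AE x in lborel. norm (q n x) \<le> M * indicator (cball 0 (R + 1)) x" for n
      using bound[of n] by (rule AE_I2)
  qed (auto simp: q_def[abs_def] simp del: of_nat_Suc)
  then show ?thesis by (simp add: int_q LIMSEQ_const_iff)
qed

text \<open>The product of \<open>f\<close> and \<phi> inherits compact support from \<phi>, so the
  integral of its partial derivative vanishes; the product rule splits that integral.\<close>

lemma integral_by_parts_test_function:
  fixes f :: "real^'n::finite \<Rightarrow> real"
  assumes f: "C_k 1 f" and \<phi>: "test_function UNIV \<phi>"
  shows "integrable lborel (\<lambda>x. f x * partial_deriv j \<phi> x)"
    and "integrable lborel (\<lambda>x. partial_deriv j f x * \<phi> x)"
    and "(LINT x|lborel. f x * partial_deriv j \<phi> x) = - (LINT x|lborel. partial_deriv j f x * \<phi> x)"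
proof -
  let ?S = "closure {x. \<phi> x \<noteq> 0}"
  have K: "compact ?S" and ck: "C_k (Suc 0) \<phi>" using \<phi> by (simp_all only: test_function_def)
  have df: "f differentiable (at x)" and d\<phi>: "\<phi> differentiable (at x)" for x
    using f ck by auto
  have c: "continuous_on UNIV f" "continuous_on UNIV \<phi>"
      "continuous_on UNIV (partial_deriv j f)" "continuous_on UNIV (partial_deriv j \<phi>)"
    using C_k_imp_continuous[OF f] C_k_imp_continuous[OF ck] f ck by simp_all
  have \<phi>0: "x \<notin> ?S \<Longrightarrow> \<phi> x = 0" for x using closure_subset[of "{x. \<phi> x \<noteq> 0}"] by auto
  show i1: "integrable lborel (\<lambda>x. f x * partial_deriv j \<phi> x)"
    by (rule integrable_continuous_compact_support[OF _ K])
       (simp_all add: partial_deriv_eq_0_outside_support continuous_on_mult c)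
  show i2: "integrable lborel (\<lambda>x. partial_deriv j f x * \<phi> x)"
    by (rule integrable_continuous_compact_support[OF continuous_on_mult[OF c(3) c(2)] K])
       (drule \<phi>0, simp)
  have pd: "partial_deriv j (\<lambda>x. f x * \<phi> x) = (\<lambda>x. f x * partial_deriv j \<phi> x + partial_deriv j f x * \<phi> x)"
    by (intro partial_deriv_mult df d\<phi>)
  have "(LINT x|lborel. partial_deriv j (\<lambda>x. f x * \<phi> x) x) = 0"
  proof (rule integral_partial_deriv_eq_0)
    show "(\<lambda>x. f x * \<phi> x) differentiable (at x)" for x by (intro differentiable_mult df d\<phi>)
    show "continuous_on UNIV (partial_deriv j (\<lambda>x. f x * \<phi> x))"
      unfolding pd by (intro continuous_on_add continuous_on_mult c)
    have "bounded {x. \<phi> x \<noteq> 0}" using K by (simp only: compact_closure)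
    then have "bounded {x. f x * \<phi> x \<noteq> 0}" by (rule bounded_subset) auto
    then show "compact (closure {x. f x * \<phi> x \<noteq> 0})" by (simp only: compact_closure)
  qed
  then show "(LINT x|lborel. f x * partial_deriv j \<phi> x) = - (LINT x|lborel. partial_deriv j f x * \<phi> x)"
    using i1 i2 by (simp add: pd)
qed

text \<open>The classical derivative satisfies the same integration by parts formula as the weak
  one, so their difference integrates to zero against every bump. Letting the bumps tend to
  indicators gives zero integrals over all boxes.\<close>

lemma weak_derivative_eq_partial_deriv:
  fixes f :: "real^'n::finite \<Rightarrow> real^'m::finite"
  assumes sob: "sobolev_W1_loc p UNIV f G" and p: "1 \<le> p"
    and f: "\<And>i. C_k 1 (\<lambda>x. f x $ i)"
  shows "AE x in lebesgue. G x $ i $ j = partial_deriv j (\<lambda>x. f x $ i) x"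
proof -
  define d where "d = partial_deriv j (\<lambda>x. f x $ i)"
  define g where "g x = G x $ i $ j" for x
  have cd: "continuous_on UNIV d" using f[of i] by (simp add: d_def)
  have md: "d \<in> borel_measurable lborel" using cd by (auto intro: borel_measurable_continuous_onI)
  have GM: "G \<in> borel_measurable lebesgue"
    and Gp: "compact C \<Longrightarrow> set_integrable lebesgue C (\<lambda>x. norm (G x) powr p)" for C
    using sob by (auto simp: sobolev_W1_loc_def locally_Lp_def lebesgue_on_UNIV_eq)
  have mg: "g \<in> borel_measurable lebesgue"
    unfolding g_def[abs_def]
    by (rule borel_measurable_continuous_on[OF _ GM]) (intro continuous_intros)
  have gC: "set_integrable lebesgue C g" if C: "compact C" for C
  proof -
    have "C \<in> sets lebesgue" using C by (simp add: lmeasurable_compact fmeasurableD)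
    \<comment> \<open>The dominating function is 1 + |G|^p: for p >= 1 the bound t <= 1 + t^p turns
      local p-integrability into local integrability.\<close>
    have "set_integrable lebesgue C (\<lambda>x. 1 :: real)"
      using lmeasurable_compact[OF C] by (simp add: set_integrable_def lmeasurable_iff_integrable)
    from set_integral_add(1)[OF this Gp[OF C]]
    show ?thesis
    proof (rule set_integrable_bound)
      show "set_borel_measurable lebesgue C g"
        unfolding set_borel_measurable_def using mg \<open>C \<in> sets lebesgue\<close> by simp
      have "norm (g x) \<le> norm (1 + norm (G x) powr p)" for x
      proof -
        have "\<bar>g x\<bar> \<le> norm (G x)" unfolding g_def
          using Finite_Cartesian_Product.norm_nth_le[of "G x $ i" j] Finite_Cartesian_Product.norm_nth_le[of "G x" i] by simp
        also have "\<dots> \<le> 1 + norm (G x) powr p"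
        proof (cases "norm (G x) \<le> 1")
          case False
          then have "norm (G x) powr 1 \<le> norm (G x) powr p" using p by (intro powr_mono) auto
          then show ?thesis using False by simp
        qed (simp add: add_increasing2)
        finally show ?thesis by simp
      qed
      then show "AE x in lebesgue. x \<in> C \<longrightarrow> norm (g x) \<le> norm (1 + norm (G x) powr p)" by simp
    qed
  qed
  have dC: "set_integrable lebesgue C d" if C: "compact C" for C
  proof -
    have i: "integrable lborel (\<lambda>x. indicator C x *\<^sub>R d x)"
      using C cd by (intro borel_integrable_compact) (auto intro: continuous_on_subset)
    then show ?thesis
      unfolding set_integrable_def using borel_measurable_integrable[OF i]
      by (subst integrable_completion) auto
  qed
  define h where "h x = g x - d x" for x
  have hC: "set_integrable lebesgue C h" if "compact C" for C
    unfolding h_def[abs_def] using gC[OF that] dC[OF that] by (rule set_integral_diff(1))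
  have mult_bump: "integrable lebesgue (\<lambda>x. u x * bump a b k x)"
    if u: "\<And>C. compact C \<Longrightarrow> set_integrable lebesgue C u" "u \<in> borel_measurable lebesgue" for u a b k
  proof (rule Bochner_Integration.integrable_bound)
    show "integrable lebesgue (\<lambda>x. indicator (cbox a b) x *\<^sub>R u x)"
      using u(1)[of "cbox a b"] by (simp add: set_integrable_def compact_cbox)
    have "bump a b k \<in> borel_measurable borel"
      using test_function_bump[of a b k] C_k_imp_continuous[of 0]
      by (intro borel_measurable_continuous_onI) (auto simp: test_function_def simp del: C_k.simps)
    then have "bump a b k \<in> borel_measurable lebesgue" by (simp add: measurable_completion)
    with u(2) show "(\<lambda>x. u x * bump a b k x) \<in> borel_measurable lebesgue" by simp
    have "norm (u x * bump a b k x) \<le> norm (indicator (cbox a b) x *\<^sub>R u x)" for x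
    proof (cases "x \<in> cbox a b")
      case True
      then show ?thesis
        using bump_nonneg[of a b k x] bump_le_1[of a b k x] by (simp add: abs_mult mult_left_le)
    next
      case False
      then have "x \<notin> box a b" using box_subset_cbox by blast
      then show ?thesis by (simp add: bump_eq_0)
    qed
    then show "AE x in lebesgue. norm (u x * bump a b k x) \<le> norm (indicator (cbox a b) x *\<^sub>R u x)" by simp
  qed
  have md': "d \<in> borel_measurable lebesgue" using md by (simp add: measurable_completion)
  have h_bump: "(LINT x|lebesgue. h x * bump a b k x) = 0" for a b k
  proof -
    let ?\<phi> = "bump a b k"
    note t = test_function_bump[of a b k]
    have "(LINT x:UNIV|lebesgue. f x $ i * partial_deriv j ?\<phi> x) = - (LINT x:UNIV|lebesgue. g x * ?\<phi> x)"
      using sob t unfolding sobolev_W1_loc_def weak_derivative_def g_def by blast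
    then have "(LINT x|lebesgue. g x * ?\<phi> x) = - (LINT x|lebesgue. f x $ i * partial_deriv j ?\<phi> x)"
      by (simp add: set_lebesgue_integral_def)
    also have "\<dots> = - (LINT x|lborel. f x $ i * partial_deriv j ?\<phi> x)"
      using integral_by_parts_test_function(1)[OF f t] by (subst integral_completion) auto
    also have "\<dots> = (LINT x|lborel. d x * ?\<phi> x)"
      using integral_by_parts_test_function(3)[OF f t] by (simp add: d_def)
    also have "\<dots> = (LINT x|lebesgue. d x * ?\<phi> x)"
      using integral_by_parts_test_function(2)[OF f t, of j i] unfolding d_def
      by (subst integral_completion) auto
    finally show ?thesis
      using mult_bump[OF gC mg, of a b k] mult_bump[OF dC md', of a b k]
      by (simp add: h_def left_diff_distrib)
  qed
  have mh: "h \<in> borel_measurable lebesgue" using mg md' by (simp add: h_def[abs_def])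
  have "AE x in lebesgue. h x = 0"
  proof (rule AE_zero_if_box_integrals_zero)
    fix a b :: "real^'n"
    show "set_integrable lebesgue (box a b) h"
      using hC[of "cbox a b"] by (rule set_integrable_subset) (auto simp: box_subset_cbox)
    have w: "integrable lebesgue (\<lambda>x. norm (indicator (cbox a b) x *\<^sub>R h x))"
      using hC[of "cbox a b"] by (intro integrable_norm) (simp add: set_integrable_def)
    have "(\<lambda>k. LINT x|lebesgue. h x * bump a b k x) \<longlonglongrightarrow> (LINT x|lebesgue. h x * indicator (box a b) x)"
    proof (rule integral_dominated_convergence[OF _ _ w])
      show "(\<lambda>x. h x * indicator (box a b) x) \<in> borel_measurable lebesgue"
        using mh by (intro borel_measurable_times borel_measurable_indicator) auto
      show "(\<lambda>x. h x * bump a b k x) \<in> borel_measurable lebesgue" for k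
        using mult_bump[OF hC mh] by (rule borel_measurable_integrable)
      show "AE x in lebesgue. (\<lambda>k. h x * bump a b k x) \<longlonglongrightarrow> h x * indicator (box a b) x"
        by (intro AE_I2 tendsto_mult tendsto_const bump_tendsto_indicator)
      have "norm (h x * bump a b k x) \<le> norm (indicator (cbox a b) x *\<^sub>R h x)" for x k
      proof (cases "x \<in> box a b")
        case True
        then have "x \<in> cbox a b" using box_subset_cbox by blast
        then show ?thesis
          using bump_nonneg[of a b k x] bump_le_1[of a b k x] by (simp add: abs_mult mult_left_le)
      qed (simp add: bump_eq_0)
      then show "AE x in lebesgue. norm (h x * bump a b k x) \<le> norm (indicator (cbox a b) x *\<^sub>R h x)" for k
        by simp
    qed
    then have "(LINT x|lebesgue. h x * indicator (box a b) x) = 0"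
      by (simp add: h_bump LIMSEQ_const_iff)
    then show "(LINT x:box a b|lebesgue. h x) = 0"
      by (simp add: set_lebesgue_integral_def mult.commute)
  qed
  then show ?thesis by eventually_elim (simp add: h_def g_def d_def)
qed

section \<open>The distortion inequality at every point\<close>

lemma jacobian_nth_eq_partial_deriv:
  fixes f :: "real^'n::finite \<Rightarrow> real^'m::finite"
  assumes "f differentiable (at x)"
  shows "jacobian f (at x) $ i $ j = partial_deriv j (\<lambda>x. f x $ i) x"
proof -
  have "(f has_derivative (\<lambda>h. jacobian f (at x) *v h)) (at x)"
    using assms by (simp add: jacobian_works)
  then have "((\<lambda>x. f x $ i) has_derivative (\<lambda>h. (jacobian f (at x) *v h) $ i)) (at x)"
    by (rule bounded_linear.has_derivative[OF bounded_linear_vec_nth])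
  from partial_deriv_has_derivative[OF this] show ?thesis
    by (simp add: matrix_vector_mult_basis column_def)
qed

lemma differentiable_if_nth_differentiable:
  fixes f :: "real^'n::finite \<Rightarrow> real^'m::finite"
  assumes "\<And>i. (\<lambda>x. f x $ i) differentiable (at x)"
  shows "f differentiable (at x)"
  unfolding differentiable_componentwise_within[of f x UNIV]
  using assms by (auto simp: Basis_vec_def inner_axis)

text \<open>The weak derivative is the Jacobian matrix almost everywhere, so the distortion
  inequality holds for the latter on a set of full measure. That set is closed by continuity, hence
  the whole space.\<close>

lemma quasiregular_imp_jacobian_bound:
  fixes f :: "real^'n::finite \<Rightarrow> real^'n"
  assumes qr: "quasiregular UNIV f" and f: "\<And>i. C_k 1 (\<lambda>x. f x $ i)"
  obtains K where "\<And>x e. norm e = 1 \<Longrightarrow> norm (jacobian f (at x) *v e) ^ CARD('n) \<le> K * jacobian_det f x"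
proof -
  obtain G K where sob: "sobolev_W1_loc (real CARD('n)) UNIV f G"
    and "AE x in lebesgue_on UNIV. onorm ((*v) (G x)) ^ CARD('n) \<le> K * det (G x)"
    using qr unfolding quasiregular_def by (elim conjE exE) (rule that)
  then have K: "AE x in lebesgue. onorm ((*v) (G x)) ^ CARD('n) \<le> K * det (G x)"
    unfolding lebesgue_on_UNIV_eq by simp
  let ?J = "\<lambda>x. jacobian f (at x)"
  have diff: "f differentiable (at x)" for x
    using f by (intro differentiable_if_nth_differentiable) simp
  have J: "?J x $ i $ j = partial_deriv j (\<lambda>x. f x $ i) x" for x i j
    by (rule jacobian_nth_eq_partial_deriv[OF diff])
  have contJ: "continuous_on UNIV (\<lambda>x. ?J x $ i $ j)" for i j
    unfolding J using f[of i] by simp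
  have "1 \<le> CARD('n)" by (simp add: Suc_le_eq)
  then have "AE x in lebesgue. G x $ i $ j = ?J x $ i $ j" for i j
    unfolding J by (intro weak_derivative_eq_partial_deriv[OF sob _ f]) simp
  then have "AE x in lebesgue. \<forall>i j. G x $ i $ j = ?J x $ i $ j"
    by (simp add: AE_all_countable)
  then have GJ: "AE x in lebesgue. G x = ?J x" by (simp add: vec_eq_iff)
  show thesis
  proof (rule that)
    fix x e :: "real^'n" assume e: "norm e = 1"
    \<comment> \<open>For a fixed unit vector both sides are continuous in the matrix entries; the
      operator norm enters only as an upper bound for the left side.\<close>
    let ?C = "{x. norm (?J x *v e) ^ CARD('n) \<le> K * det (?J x)}"
    have "continuous_on UNIV (\<lambda>x. det (?J x))"
      unfolding det_def by (intro continuous_intros contJ)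
    moreover have "continuous_on UNIV (\<lambda>x. ?J x *v e)"
      unfolding matrix_vector_mult_def by (intro continuous_intros contJ)
    ultimately have "closed ?C" by (intro closed_Collect_le continuous_intros)
    moreover have "AE x in lebesgue. x \<in> ?C"
      using GJ K
    proof eventually_elim
      case (elim x)
      have "norm (G x *v e) \<le> onorm ((*v) (G x)) * norm e"
        by (intro onorm matrix_vector_mul_bounded_linear)
      then have "norm (G x *v e) ^ CARD('n) \<le> onorm ((*v) (G x)) ^ CARD('n)"
        using e by (intro power_mono) auto
      with elim show ?case by simp
    qed
    ultimately have "x \<in> ?C" by (rule mem_closed_if_AE_lebesgue)
    then show "norm (?J x *v e) ^ CARD('n) \<le> K * jacobian_det f x" by (simp add: jacobian_det_def)
  qed
qed

section \<open>Facets of the icosahedron\<close>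

text \<open>The number 1/sqrt 5 is the cosine of the angle that an edge of a regular icosahedron
  subtends at the centre.\<close>

definition equiangular :: "'a::real_inner set \<Rightarrow> bool" where
  "equiangular T \<longleftrightarrow> (\<forall>v\<in>T. \<forall>w\<in>T. v \<noteq> w \<longrightarrow> v \<bullet> w = 1 / sqrt 5)"

text \<open>Collects the metric facts about the vertices from which the facets are found without
  coordinates. In \<open>common_neighbours\<close>, \<open>v\<close> and \<open>w\<close> are the
  far corners of two triangles glued along the edge from \<open>p\<close> to
  \<open>q\<close>.\<close>

locale icosahedral =
  fixes V :: "(real^3) set"
  assumes finite: "finite V"
    and norm: "\<And>v. v \<in> V \<Longrightarrow> norm v = 1"
    and uminus: "\<And>v. v \<in> V \<Longrightarrow> - v \<in> V"
    and inner: "\<And>v w. v \<in> V \<Longrightarrow> w \<in> V \<Longrightarrow> v \<noteq> w \<Longrightarrow> v \<noteq> - w \<Longrightarrow>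
      v \<bullet> w = 1 / sqrt 5 \<or> v \<bullet> w = - (1 / sqrt 5)"
    and common_neighbours: "\<And>v w. v \<in> V \<Longrightarrow> w \<in> V \<Longrightarrow> v \<bullet> w = - (1 / sqrt 5) \<Longrightarrow>
      \<exists>p\<in>V. \<exists>q\<in>V. p \<bullet> q = 1 / sqrt 5 \<and> v \<bullet> p = 1 / sqrt 5 \<and> v \<bullet> q = 1 / sqrt 5 \<and>
        w \<bullet> p = 1 / sqrt 5 \<and> w \<bullet> q = 1 / sqrt 5"
    and five_triangles: "\<And>v. v \<in> V \<Longrightarrow>
      card {T. T \<subseteq> V \<and> card T = 3 \<and> equiangular T \<and> v \<in> T} = 5"
    and nonempty: "V \<noteq> {}"
begin

abbreviation "P \<equiv> convex hull V"

section \<open>Independence, extreme points and dimension\<close>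

lemma inv_sqrt5: "0 < 1 / sqrt 5" "1 / sqrt 5 < 1" "(1 / sqrt 5) * (1 / sqrt 5) = 1 / 5"
  by (auto simp: real_less_rsqrt)

lemma inner_self: "v \<in> V \<Longrightarrow> v \<bullet> v = 1"
  by (simp add: norm dot_square_norm)

text \<open>The Gram matrix is 1 - c times the identity plus c times the all-ones matrix,
  nonsingular for 0 < c < 1. Pairing a linear relation with each member, then summing, first kills
  the sum of the coefficients and then each coefficient.\<close>

lemma equiangular_independent:
  assumes "T \<subseteq> V" "equiangular T"
  shows "independent T"
proof
  define c where "c = 1 / sqrt 5"
  have fT: "finite T" using assms finite finite_subset by blast
  assume "dependent T"
  then obtain u v where v: "v \<in> T" "u v \<noteq> 0" and u: "(\<Sum>t\<in>T. u t *\<^sub>R t) = 0"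
    using dependent_finite[OF fT] by blast
  have eq: "u w * (1 - c) = - c * sum u T" if w: "w \<in> T" for w
  proof -
    have "0 = (\<Sum>t\<in>T. u t *\<^sub>R t) \<bullet> w" by (simp add: u)
    also have "\<dots> = (\<Sum>t\<in>T. u t * c + (if t = w then u t * (1 - c) else 0))"
      unfolding inner_sum_left
      using assms w inner_self by (intro sum.cong) (auto simp: equiangular_def c_def algebra_simps)
    also have "\<dots> = c * sum u T + u w * (1 - c)"
      using fT w by (simp add: sum.distrib sum.delta sum_distrib_left mult.commute)
    finally show ?thesis by simp
  qed
  have c: "0 < c" "c < 1" using inv_sqrt5 by (simp_all add: c_def)
  have "sum u T * (1 - c) = (\<Sum>t\<in>T. u t * (1 - c))" by (simp add: sum_distrib_right)
  also have "\<dots> = (\<Sum>t\<in>T. - c * sum u T)" by (intro sum.cong refl eq)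
  also have "\<dots> = - (card T * c) * sum u T" by simp
  finally have "(1 - c + card T * c) * sum u T = 0" by (simp add: algebra_simps)
  moreover have "1 - c + card T * c > 0" using c by (intro add_pos_nonneg) auto
  ultimately have "sum u T = 0" by simp
  then show False using eq[OF v(1)] v(2) c by simp
qed

text \<open>The hull lies in the closed unit ball and its generators on the unit sphere; by strict
  convexity of the ball no point of norm 1 is interior to a segment.\<close>

lemma extreme_point_iff: "v extreme_point_of P \<longleftrightarrow> v \<in> V"
proof
  assume v: "v \<in> V"
  have ball: "P \<subseteq> cball 0 1" using norm by (intro hull_minimal) (auto simp: convex_cball)
  have "v \<notin> open_segment a b" if "a \<in> P" "b \<in> P" for a b
    using dist_decreases_open_segment[of v a b 0] that ball norm[OF v] by fastforce
  then show "v extreme_point_of P"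
    using v by (auto simp: extreme_point_of_def hull_inc)
qed (rule extreme_point_of_convex_hull)

text \<open>An extreme point of \<open>P\<close> stays extreme in any smaller hull containing it,
  hence is one of its generators. This lets a triangle be recovered from its convex hull.\<close>

lemma mem_convex_hull_subset_iff:
  assumes "T \<subseteq> V" "v \<in> V"
  shows "v \<in> convex hull T \<longleftrightarrow> v \<in> T"
proof
  assume "v \<in> convex hull T"
  moreover have "convex hull T \<subseteq> P" using assms(1) by (rule hull_mono)
  moreover have "v extreme_point_of P" using assms(2) by (simp add: extreme_point_iff)
  ultimately have "v extreme_point_of convex hull T" unfolding extreme_point_of_def by blast
  then show "v \<in> T" by (rule extreme_point_of_convex_hull)
qed (rule hull_inc)

lemma aff_dim_triangle:
  assumes "T \<subseteq> V" "card T = 3" "equiangular T"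
  shows "aff_dim T = 2"
  using aff_dim_affine_independent[of T] affine_dependent_imp_dependent[of T]
    equiangular_independent[OF assms(1,3)] assms(2)
  by (auto simp: aff_dim_convex_hull)

text \<open>The centre is the midpoint of an antipodal pair, so affine and linear dimension agree;
  an equiangular triple supplies three independent vectors.\<close>

lemma aff_dim_vertices: "aff_dim V = 3"
proof -
  obtain v where v: "v \<in> V" using nonempty by blast
  obtain T where T: "T \<subseteq> V" "card T = 3" "equiangular T"
    using five_triangles[OF v] by (metis (mono_tags, lifting) Collect_empty_eq card.empty zero_neq_numeral)
  have "0 = (1 / 2) *\<^sub>R v + (1 / 2) *\<^sub>R (- v)" by simp
  then have "0 \<in> convex hull V"
    using v uminus[OF v] by (metis (no_types) convexD convex_convex_hull field_sum_of_halves half_gt_zero hull_inc less_eq_real_def zero_less_one)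
  then have "0 \<in> affine hull V" using convex_hull_subset_affine_hull by blast
  then have "aff_dim V = dim V" by (rule aff_dim_zero)
  moreover have "3 \<le> dim V"
    using independent_card_le_dim[OF T(1) equiangular_independent[OF T(1,3)]] T(2) by simp
  moreover have "dim V \<le> 3" using dim_subset_UNIV[of V] by simp
  ultimately show ?thesis by (simp add: aff_dim_convex_hull)
qed

text \<open>A facet cannot contain two vertices \<open>v, w\<close> at obtuse angle: their midpoint is a point of the
  edge between the two common neighbours, shrunk towards the centre.\<close>

lemma facet_imp_triangle:
  assumes F: "F facet_of P"
  shows "\<exists>T. T \<subseteq> V \<and> card T = 3 \<and> equiangular T \<and> F = convex hull T"
proof -
  have face: "F face_of P" using F by (simp add: facet_of_def)
  obtain T where T: "T \<subseteq> V" "F = convex hull T"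
    by (rule face_of_convex_hull_subset[OF finite_imp_compact[OF finite] face])
  have "F exposed_face_of P"
    using face finite by (simp add: exposed_face_of_polyhedron polyhedron_convex_hull)
  then obtain a b where ab: "P \<subseteq> {x. a \<bullet> x \<le> b}" "F = P \<inter> {x. a \<bullet> x = b}"
    unfolding exposed_face_of_def by blast
  have le: "a \<bullet> v \<le> b" if "v \<in> V" for v using ab(1) that hull_inc[of v V] by blast
  have eq: "a \<bullet> v = b" if "v \<in> T" for v
    using ab(2) T(2) that hull_inc[of v T] by blast
  \<comment> \<open>A functional bounded above by 0 on an antipodally symmetric set vanishes on it,
    so the face would be all of \<open>P\<close>.\<close>
  have "b \<noteq> 0"
  proof
    assume "b = 0"
    then have "a \<bullet> v = 0" if "v \<in> V" for v
      using le[OF that] le[OF uminus[OF that]] by (simp add: inner_minus_right)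
    then have "P \<subseteq> {x. a \<bullet> x = 0}" by (intro hull_minimal convex_hyperplane) auto
    then have "F = P" using ab(2) \<open>b = 0\<close> by blast
    then show False using F by simp
  qed
  moreover obtain v where "v \<in> V" using nonempty by blast
  then have "0 \<le> b" using le[of v] le[OF uminus, of v] by (simp add: inner_minus_right)
  ultimately have b: "b > 0" by simp
  have ea: "equiangular T"
    unfolding equiangular_def
  proof (intro ballI impI)
    fix v w assume vw: "v \<in> T" "w \<in> T" "v \<noteq> w"
    then have V: "v \<in> V" "w \<in> V" using T by auto
    have "v \<noteq> - w" using eq[OF vw(1)] eq[OF vw(2)] b by (auto simp: inner_minus_right)
    moreover have "v \<bullet> w \<noteq> - (1 / sqrt 5)"
    proof
      assume neg: "v \<bullet> w = - (1 / sqrt 5)"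
      then obtain p q where pq: "p \<in> V" "q \<in> V" "p \<bullet> q = 1 / sqrt 5" "v \<bullet> p = 1 / sqrt 5"
          "v \<bullet> q = 1 / sqrt 5" "w \<bullet> p = 1 / sqrt 5" "w \<bullet> q = 1 / sqrt 5"
        using common_neighbours[OF V] by blast
      define c where "c = 1 / sqrt 5"
      \<comment> \<open>The coefficient of the orthogonal projection of \<open>v + w\<close> onto
        \<open>p + q\<close>: their inner product is 4c and \<open>p + q\<close> has squared norm 2
        + 2c.\<close>
      define \<kappa> where "\<kappa> = 2 * c / (1 + c)"
      have c: "0 < c" "c < 1" "c * c = 1 / 5" using inv_sqrt5 by (simp_all add: c_def)
      have \<kappa>: "\<kappa> < 1" "0 < \<kappa>" "\<kappa> * (1 + c) = 2 * c" using c by (auto simp: \<kappa>_def field_simps)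
      let ?d = "v + w - \<kappa> *\<^sub>R (p + q)"
      note V' = V pq(1,2)
      have ips: "v \<bullet> v = 1" "w \<bullet> w = 1" "p \<bullet> p = 1" "q \<bullet> q = 1" "v \<bullet> w = - c" "w \<bullet> v = - c"
          "p \<bullet> q = c" "q \<bullet> p = c" "v \<bullet> p = c" "p \<bullet> v = c" "v \<bullet> q = c" "q \<bullet> v = c"
          "w \<bullet> p = c" "p \<bullet> w = c" "w \<bullet> q = c" "q \<bullet> w = c"
        using pq neg V'[THEN inner_self] by (simp_all add: c_def inner_commute)
      have "?d \<bullet> ?d = 2 - 2 * c + \<kappa> * (\<kappa> * (1 + c)) * 2 - 8 * \<kappa> * c"
        by (simp add: inner_add_left inner_add_right inner_diff_left inner_diff_right ips)
           (simp add: algebra_simps)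
      also have "\<dots> = 2 - 2 * c - 4 * \<kappa> * c" by (simp add: \<kappa>(3))
      \<comment> \<open>After multiplication by 1 + c this is 2 - 10 c^2, so the value c^2 = 1/5
        makes \<open>v + w\<close> a multiple of \<open>p + q\<close>.\<close>
      also have "\<dots> * (1 + c) = 2 * (1 - c * c) - 4 * c * (\<kappa> * (1 + c))" by (simp add: algebra_simps)
      also have "\<dots> = 0" by (simp add: \<kappa>(3) c(3))
      finally have "?d \<bullet> ?d = 0" using c by auto
      then have "v + w = \<kappa> *\<^sub>R (p + q)" by simp
      \<comment> \<open>The supporting functional takes the value 2b on the left but at most
        \<kappa> times 2b on the right, with \<kappa> < 1.\<close>
      then have "a \<bullet> (v + w) = a \<bullet> (\<kappa> *\<^sub>R (p + q))" by simp
      then have "2 * b = \<kappa> * (a \<bullet> p + a \<bullet> q)"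
        using eq vw by (simp add: inner_add_right)
      also have "\<dots> \<le> \<kappa> * (2 * b)" using le[OF pq(1)] le[OF pq(2)] \<kappa> by (intro mult_left_mono) auto
      also have "\<dots> < 2 * b" using \<kappa> b by simp
      finally show False by simp
    qed
    ultimately show "v \<bullet> w = 1 / sqrt 5" using inner[OF V vw(3)] by blast
  qed
  have fT: "finite T" using T(1) finite finite_subset by blast
  have "card T \<le> 3"
    using independent_bound[OF equiangular_independent[OF T(1) ea]] by simp
  moreover have "aff_dim T = 2"
    using F T(2) by (simp add: facet_of_def aff_dim_vertices aff_dim_convex_hull)
  then have "card T \<ge> 3" using aff_dim_le_card[OF fT] by simp
  ultimately show ?thesis using T ea by (intro exI[of _ T]) simp
qed

text \<open>The sum of the three vertices is an outward normal: its inner product is 1 + 2c with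
  each of them and at most 3c, which is smaller, with every other vertex.\<close>

lemma triangle_facet:
  assumes T: "T \<subseteq> V" "card T = 3" "equiangular T"
  shows "convex hull T facet_of P"
proof -
  define c where "c = 1 / sqrt 5"
  have c: "0 < c" "c < 1" using inv_sqrt5 by (simp_all add: c_def)
  define n where "n = \<Sum>T"
  have fT: "finite T" using T(2) card.infinite by fastforce
  have nT: "n \<bullet> v = 1 + 2 * c" if "v \<in> T" for v
  proof -
    have "n \<bullet> v = (\<Sum>t\<in>T. t \<bullet> v)" by (simp add: n_def inner_sum_left)
    also have "\<dots> = (\<Sum>t\<in>T. c + (if t = v then 1 - c else 0))"
      using T that inner_self by (intro sum.cong) (auto simp: equiangular_def c_def)
    also have "\<dots> = 1 + 2 * c" using fT that T(2) by (simp add: sum.distrib sum.delta)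
    finally show ?thesis .
  qed
  have nV: "n \<bullet> v < 1 + 2 * c" if "v \<in> V" "v \<notin> T" for v
  proof -
    have "n \<bullet> v = (\<Sum>t\<in>T. t \<bullet> v)" by (simp add: n_def inner_sum_left)
    also have "\<dots> \<le> (\<Sum>t\<in>T. c)"
    proof (rule sum_mono)
      fix t assume "t \<in> T"
      then have t: "t \<in> V" "t \<noteq> v" using T that by auto
      show "t \<bullet> v \<le> c"
        using inner[OF t(1) that(1) t(2), folded c_def] c inner_self[OF that(1)]
        by (cases "t = - v") (auto simp: inner_minus_left)
    qed
    finally show ?thesis using c T(2) by simp
  qed
  have "v \<in> V \<Longrightarrow> n \<bullet> v \<le> 1 + 2 * c" for v using nT[of v] nV[of v] by (cases "v \<in> T") auto
  then have "P \<subseteq> {x. n \<bullet> x \<le> 1 + 2 * c}" by (intro hull_minimal convex_halfspace_le) auto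
  then have face: "P \<inter> {x. n \<bullet> x = 1 + 2 * c} face_of P" (is "?F face_of P")
    by (intro face_of_Int_supporting_hyperplane_le) auto
  obtain S where S: "S \<subseteq> V" "?F = convex hull S"
    by (rule face_of_convex_hull_subset[OF finite_imp_compact[OF finite] face])
  \<comment> \<open>The generators of the face are vertices on the supporting plane, and only those
    of \<open>T\<close> reach it.\<close>
  have "S \<subseteq> ?F" using S(2) hull_subset[of S convex] by simp
  then have "S \<subseteq> T" using nV S(1) by fastforce
  then have "?F \<subseteq> convex hull T" using S(2) by (simp add: hull_mono)
  moreover have "convex hull T \<subseteq> ?F"
    using T(1) nT hull_inc[of _ V] by (intro hull_minimal face_of_imp_convex[OF face]) auto
  ultimately have "convex hull T face_of P" using face by simp
  moreover have "T \<noteq> {}" using T(2) by auto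
  ultimately show ?thesis
    by (simp add: facet_of_def aff_dim_vertices aff_dim_convex_hull aff_dim_triangle[OF T])
qed

text \<open>The squared edge length is 2 - 2 times the common inner product. Taking hulls is a
  bijection from equiangular triples through \<open>v\<close> to facets through \<open>v\<close>,
  with inverse intersection with \<open>V\<close>, so \<open>five_triangles\<close> gives the
  count.\<close>

lemma regular_icosahedron_hull: "regular_icosahedron P"
  unfolding regular_icosahedron_def
proof (intro conjI allI impI exI[of _ "sqrt (2 - 2 / sqrt 5)"])
  show "polytope P" using finite by (rule polytope_convex_hull)
  show "aff_dim P = 3" by (simp add: aff_dim_vertices aff_dim_convex_hull)
  show "0 < sqrt (2 - 2 / sqrt 5)" using inv_sqrt5 by (simp add: divide_simps)
next
  fix F assume "F facet_of P"
  then obtain T where T: "T \<subseteq> V" "card T = 3" "equiangular T" "F = convex hull T"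
    using facet_imp_triangle by blast
  have dist: "dist v w = sqrt (2 - 2 / sqrt 5)" if "v \<in> T" "w \<in> T" "v \<noteq> w" for v w
  proof -
    have "v \<bullet> v = 1" "w \<bullet> w = 1" "v \<bullet> w = 1 / sqrt 5"
      using that T inner_self by (auto simp: equiangular_def)
    then have "(v - w) \<bullet> (v - w) = 2 - 2 / sqrt 5"
      by (simp add: inner_diff_left inner_diff_right inner_commute[of w v])
    then show ?thesis by (simp add: dist_norm norm_eq_sqrt_inner)
  qed
  obtain a b c where abc: "T = {a, b, c}" "a \<noteq> b" "b \<noteq> c" "a \<noteq> c"
    using T(2) by (auto simp: card_3_iff)
  have "dist a b = sqrt (2 - 2 / sqrt 5)" "dist b c = sqrt (2 - 2 / sqrt 5)"
      "dist c a = sqrt (2 - 2 / sqrt 5)"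
    using abc by (auto intro: dist)
  then show "\<exists>a b c. F = convex hull {a, b, c} \<and> dist a b = sqrt (2 - 2 / sqrt 5) \<and>
      dist b c = sqrt (2 - 2 / sqrt 5) \<and> dist c a = sqrt (2 - 2 / sqrt 5)"
    using T(4) abc(1) by blast
next
  fix v assume "v extreme_point_of P"
  then have v: "v \<in> V" by (simp add: extreme_point_iff)
  let ?S = "{T. T \<subseteq> V \<and> card T = 3 \<and> equiangular T \<and> v \<in> T}"
  have "{F. F facet_of P \<and> v \<in> F} = (hull) convex ` ?S"
  proof (intro set_eqI iffI)
    fix F assume "F \<in> {F. F facet_of P \<and> v \<in> F}"
    then obtain T where "T \<subseteq> V" "card T = 3" "equiangular T" "F = convex hull T" "v \<in> F"
      using facet_imp_triangle by blast
    then show "F \<in> (hull) convex ` ?S" using v mem_convex_hull_subset_iff by blast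
  next
    fix F assume "F \<in> (hull) convex ` ?S"
    then show "F \<in> {F. F facet_of P \<and> v \<in> F}" using triangle_facet hull_inc by fastforce
  qed
  moreover have "inj_on ((hull) convex) ?S"
  proof (rule inj_onI)
    fix S T assume ST: "S \<in> ?S" "T \<in> ?S" "convex hull S = convex hull T"
    then have "S = V \<inter> convex hull S" "T = V \<inter> convex hull T"
      using mem_convex_hull_subset_iff by blast+
    then show "S = T" using ST(3) by simp
  qed
  ultimately show "card {F. F facet_of P \<and> v \<in> F} = 5"
    using five_triangles[OF v] by (simp add: card_image)
qed

end

section \<open>The cubic mapping\<close>

definition golden :: real where "golden = (1 + sqrt 5) / 2"

lemma golden_square: "golden * golden = golden + 1"
  by (simp add: golden_def field_simps)

text \<open>The form of \<open>golden_square\<close> that applies inside right-nested products;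
  together they reduce polynomials in \<open>golden\<close> to degree one.\<close>

lemma golden_mult_golden_mult: "golden * (golden * a) = golden * a + a"
  by (simp add: golden_square distrib_right flip: mult.assoc)

lemma golden_gt_1: "golden > 1"
  by (simp add: golden_def real_less_rsqrt)

lemma golden_power_simps:
  "golden\<^sup>2 = golden + 1" "golden ^ 3 = 2 * golden + 1" "golden ^ 4 = 3 * golden + 2"
  by (simp_all add: eval_nat_numeral golden_square golden_mult_golden_mult algebra_simps)

definition Q1 :: "real \<Rightarrow> real \<Rightarrow> real \<Rightarrow> real" where
  "Q1 x y z = x * (golden\<^sup>2 * y\<^sup>2 - golden / 3 * x\<^sup>2 - z\<^sup>2)"

definition Qmap :: "real^3 \<Rightarrow> real^3" where
  "Qmap x = vector [Q1 (x $ 1) (x $ 2) (x $ 3), Q1 (x $ 2) (x $ 3) (x $ 1), Q1 (x $ 3) (x $ 1) (x $ 2)]"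

lemma Qmap_nth:
  "Qmap x $ 1 = Q1 (x $ 1) (x $ 2) (x $ 3)"
  "Qmap x $ 2 = Q1 (x $ 2) (x $ 3) (x $ 1)"
  "Qmap x $ 3 = Q1 (x $ 3) (x $ 1) (x $ 2)"
  by (simp_all add: Qmap_def)

section \<open>Homogeneity, smoothness and harmonicity of the components\<close>

lemma homogeneous_polynomial_monomial:
  "homogeneous_polynomial 3 (\<lambda>x::real^'n::finite. x $ i * x $ j * x $ k)"
proof -
  define \<beta> :: "'n \<Rightarrow> nat" where "\<beta> m = of_bool (m = i) + of_bool (m = j) + of_bool (m = k)" for m
  \<comment> \<open>Exponents are bounded by the total degree. Finiteness matters because a sum over
    an infinite index set defaults to zero.\<close>
  have fin: "finite {\<alpha>::'n \<Rightarrow> nat. (\<Sum>m\<in>UNIV. \<alpha> m) = 3}"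
  proof (rule finite_subset)
    have "\<alpha> m \<le> 3" if "(\<Sum>m\<in>UNIV. \<alpha> m) = 3" for \<alpha> :: "'n \<Rightarrow> nat" and m
      using member_le_sum[of m UNIV \<alpha>] that by simp
    then show "{\<alpha>::'n \<Rightarrow> nat. (\<Sum>m\<in>UNIV. \<alpha> m) = 3} \<subseteq> PiE UNIV (\<lambda>_. {..3})"
      by auto
  qed (simp add: finite_PiE)
  have "(\<Sum>m\<in>UNIV. \<beta> m) = 3" by (simp add: \<beta>_def sum.distrib)
  moreover have "(\<Prod>m\<in>UNIV. x $ m ^ \<beta> m) = x $ i * x $ j * x $ k" for x :: "real^'n"
  proof -
    have p: "(\<Prod>m\<in>UNIV. x $ m ^ of_bool (m = l)) = x $ l" for l
    proof -
      have "(\<Prod>m\<in>UNIV. x $ m ^ of_bool (m = l)) = (\<Prod>m\<in>UNIV. if m = l then x $ m else 1)"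
        by (intro prod.cong) auto
      then show ?thesis by simp
    qed
    show ?thesis by (simp add: \<beta>_def power_add prod.distrib p)
  qed
  moreover have "(\<Sum>\<alpha> | (\<Sum>m\<in>UNIV. \<alpha> m) = 3. of_bool (\<alpha> = \<beta>) * (\<Prod>m\<in>UNIV. x $ m ^ \<alpha> m))
      = (\<Sum>\<alpha> | (\<Sum>m\<in>UNIV. \<alpha> m) = 3. if \<alpha> = \<beta> then \<Prod>m\<in>UNIV. x $ m ^ \<alpha> m else 0)" for x :: "real^'n"
    by (intro sum.cong) auto
  ultimately show ?thesis
    unfolding homogeneous_polynomial_def using fin
    by (intro exI[of _ "\<lambda>\<alpha>. of_bool (\<alpha> = \<beta>)"]) (simp add: sum.delta)
qed

lemma homogeneous_polynomial_add:
  "homogeneous_polynomial d f \<Longrightarrow> homogeneous_polynomial d g \<Longrightarrow> homogeneous_polynomial d (\<lambda>x. f x + g x)"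
  unfolding homogeneous_polynomial_def
proof (elim exE)
  fix a b
  assume "\<forall>x. f x = (\<Sum>\<alpha> | sum \<alpha> UNIV = d. a \<alpha> * (\<Prod>i\<in>UNIV. x $ i ^ \<alpha> i))"
    and "\<forall>x. g x = (\<Sum>\<alpha> | sum \<alpha> UNIV = d. b \<alpha> * (\<Prod>i\<in>UNIV. x $ i ^ \<alpha> i))"
  then show "\<exists>c. \<forall>x. f x + g x = (\<Sum>\<alpha> | sum \<alpha> UNIV = d. c \<alpha> * (\<Prod>i\<in>UNIV. x $ i ^ \<alpha> i))"
    by (intro exI[of _ "\<lambda>\<alpha>. a \<alpha> + b \<alpha>"]) (simp add: distrib_right sum.distrib)
qed

lemma homogeneous_polynomial_cmult:
  "homogeneous_polynomial d f \<Longrightarrow> homogeneous_polynomial d (\<lambda>x. r * f x)"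
  unfolding homogeneous_polynomial_def
proof (elim exE)
  fix a
  assume "\<forall>x. f x = (\<Sum>\<alpha> | sum \<alpha> UNIV = d. a \<alpha> * (\<Prod>i\<in>UNIV. x $ i ^ \<alpha> i))"
  then show "\<exists>c. \<forall>x. r * f x = (\<Sum>\<alpha> | sum \<alpha> UNIV = d. c \<alpha> * (\<Prod>i\<in>UNIV. x $ i ^ \<alpha> i))"
    by (intro exI[of _ "\<lambda>\<alpha>. r * a \<alpha>"]) (simp add: sum_distrib_left mult.assoc)
qed

lemma homogeneous_polynomial_Q1: "homogeneous_polynomial 3 (\<lambda>x::real^3. Q1 (x $ i) (x $ j) (x $ k))"
proof -
  have "homogeneous_polynomial 3 (\<lambda>x::real^3. golden\<^sup>2 * (x $ i * x $ j * x $ j)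
      + (- (golden / 3) * (x $ i * x $ i * x $ i) + (- 1) * (x $ i * x $ k * x $ k)))"
    by (intro homogeneous_polynomial_add homogeneous_polynomial_cmult homogeneous_polynomial_monomial)
  then show ?thesis by (simp add: Q1_def algebra_simps power2_eq_square)
qed

lemma C_k_Q1: "C_k m (\<lambda>x::real^3. Q1 (x $ i) (x $ j) (x $ k))"
proof -
  have "C_k m (\<lambda>x::real^3. golden\<^sup>2 * (x $ i * x $ j * x $ j)
      + (- (golden / 3) * (x $ i * x $ i * x $ i) + (- 1) * (x $ i * x $ k * x $ k)))"
    by (intro C_k_add C_k_mult C_k_const C_k_nth)
  then show ?thesis by (simp add: Q1_def algebra_simps power2_eq_square)
qed

lemma has_derivative_nth: "((\<lambda>x. x $ i) has_derivative (\<lambda>h. h $ i)) F"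
  by (intro bounded_linear_imp_has_derivative bounded_linear_vec_nth)

definition dQ1 :: "real^3 \<Rightarrow> 3 \<Rightarrow> 3 \<Rightarrow> 3 \<Rightarrow> real^3 \<Rightarrow> real" where
  "dQ1 x i j k h = (golden\<^sup>2 * (x $ j)\<^sup>2 - golden * (x $ i)\<^sup>2 - (x $ k)\<^sup>2) * h $ i
     + 2 * golden\<^sup>2 * x $ i * x $ j * h $ j - 2 * x $ i * x $ k * h $ k"

lemma has_derivative_Q1:
  "((\<lambda>x. Q1 (x $ i) (x $ j) (x $ k)) has_derivative dQ1 x i j k) (at x)"
  unfolding Q1_def dQ1_def[abs_def]
  by (auto intro!: derivative_eq_intros has_derivative_nth simp: algebra_simps power2_eq_square)

text \<open>The pure second derivatives add up to 2 (golden^2 - golden - 1) times the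
  \<open>i\<close>-th coordinate, which is zero by the equation of the golden ratio.\<close>

lemma harmonic_Q1:
  assumes "i \<noteq> j" "j \<noteq> k" "i \<noteq> k"
  shows "harmonic (\<lambda>x::real^3. Q1 (x $ i) (x $ j) (x $ k))"
proof -
  let ?q = "\<lambda>x::real^3. Q1 (x $ i) (x $ j) (x $ k)"
  have U: "UNIV = {i, j, k}"
    using assms by (intro card_subset_eq[symmetric]) auto
  have 1: "partial_deriv l ?q = (\<lambda>x. dQ1 x i j k (axis l 1))" for l
    by (simp add: fun_eq_iff partial_deriv_has_derivative[OF has_derivative_Q1])
  have D: "((\<lambda>x. dQ1 x i j k (axis i 1)) has_derivative
      (\<lambda>h. 2 * golden\<^sup>2 * x $ j * h $ j - 2 * golden * x $ i * h $ i - 2 * x $ k * h $ k)) (at x)"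
    and D': "((\<lambda>x. dQ1 x i j k (axis j 1)) has_derivative
      (\<lambda>h. 2 * golden\<^sup>2 * (x $ i * h $ j + x $ j * h $ i))) (at x)"
    and D'': "((\<lambda>x. dQ1 x i j k (axis k 1)) has_derivative
      (\<lambda>h. - 2 * (x $ i * h $ k + x $ k * h $ i))) (at x)" for x
    using assms unfolding dQ1_def[abs_def]
    by (auto intro!: derivative_eq_intros has_derivative_nth simp: axis_def algebra_simps)
  have "laplacian ?q x = 0" for x
    using assms
    by (simp add: laplacian_def 1 U D[THEN partial_deriv_has_derivative]
        D'[THEN partial_deriv_has_derivative] D''[THEN partial_deriv_has_derivative])
       (simp add: axis_def golden_power_simps algebra_simps)
  then show ?thesis by (simp add: harmonic_def C_k_Q1)
qed

lemma homogeneous_harmonic_cubic_Qmap: "homogeneous_harmonic_cubic Qmap"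
  unfolding homogeneous_harmonic_cubic_def
  by (simp add: forall_3 Qmap_nth homogeneous_polynomial_Q1 harmonic_Q1)

lemma C_k_Qmap: "C_k m (\<lambda>x. Qmap x $ i)"
  using exhaust_3[of i] by (auto simp: Qmap_nth C_k_Q1)

section \<open>The Jacobian determinant as a sum of nonnegative terms\<close>

lemma jacobian_Qmap:
  "jacobian Qmap (at x) $ 1 $ l = dQ1 x 1 2 3 (axis l 1)"
  "jacobian Qmap (at x) $ 2 $ l = dQ1 x 2 3 1 (axis l 1)"
  "jacobian Qmap (at x) $ 3 $ l = dQ1 x 3 1 2 (axis l 1)"
proof -
  have "Qmap differentiable (at x)"
    using C_k_Qmap[of 1] by (intro differentiable_if_nth_differentiable) simp
  note J = jacobian_nth_eq_partial_deriv[OF this]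
  show "jacobian Qmap (at x) $ 1 $ l = dQ1 x 1 2 3 (axis l 1)"
  "jacobian Qmap (at x) $ 2 $ l = dQ1 x 2 3 1 (axis l 1)"
  "jacobian Qmap (at x) $ 3 $ l = dQ1 x 3 1 2 (axis l 1)"
    by (simp_all add: J Qmap_nth partial_deriv_has_derivative[OF has_derivative_Q1])
qed

text \<open>As a linear form in the squared coordinates, \<open>L\<close> vanishes at \<open>(1, golden\<^sup>2, 0)\<close>
  and \<open>(golden\<^sup>2, 0, 1)\<close>, which come from the vertices with nonzero first coordinate; this
  determines it up to scale.\<close>

definition L :: "real \<Rightarrow> real \<Rightarrow> real \<Rightarrow> real" where
  "L a b c = golden ^ 4 * c + b - golden\<^sup>2 * a"

text \<open>A polynomial identity in the coordinates, checked by expanding and reducing powers of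
  \<open>golden\<close>. The factor \<open>golden\<close> on the left matches the normalisation of
  \<open>L\<close>: at the first unit vector both sides equal golden^4.\<close>

lemma jacobian_det_Qmap:
  "golden * jacobian_det Qmap x =
     (x $ 1)\<^sup>2 * (L ((x $ 1)\<^sup>2) ((x $ 2)\<^sup>2) ((x $ 3)\<^sup>2))\<^sup>2
   + (x $ 2)\<^sup>2 * (L ((x $ 2)\<^sup>2) ((x $ 3)\<^sup>2) ((x $ 1)\<^sup>2))\<^sup>2
   + (x $ 3)\<^sup>2 * (L ((x $ 3)\<^sup>2) ((x $ 1)\<^sup>2) ((x $ 2)\<^sup>2))\<^sup>2
   + 20 * golden ^ 4 * (x $ 1)\<^sup>2 * (x $ 2)\<^sup>2 * (x $ 3)\<^sup>2"
  unfolding jacobian_det_def det_3 jacobian_Qmap dQ1_def L_def golden_power_simps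
  by (simp add: axis_def power2_eq_square algebra_simps golden_mult_golden_mult golden_square)
section \<open>The twelve vertices\<close>

datatype coord = X | Y | Z

fun next_coord :: "coord \<Rightarrow> coord" where
  "next_coord X = Y" | "next_coord Y = Z" | "next_coord Z = X"

definition sign :: "bool \<Rightarrow> real" where "sign s = (if s then 1 else - 1)"

text \<open>The cyclic permutations of (0, +-1, +-golden). The label names the vanishing coordinate,
  \<open>s\<close> is the sign of the cyclically next one and \<open>t\<close> that of the one
  after.\<close>

fun raw_vertex :: "coord \<times> bool \<times> bool \<Rightarrow> real^3" where
  "raw_vertex (X, s, t) = vector [0, sign s, golden * sign t]"
| "raw_vertex (Y, s, t) = vector [golden * sign t, 0, sign s]"
| "raw_vertex (Z, s, t) = vector [sign s, golden * sign t, 0]"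

text \<open>The squared norm of a raw vertex is 1 + golden^2 = golden + 2.\<close>

definition vertex :: "coord \<times> bool \<times> bool \<Rightarrow> real^3" where
  "vertex x = (1 / sqrt (golden + 2)) *\<^sub>R raw_vertex x"

definition vertices :: "(real^3) set" where "vertices = range vertex"

fun opposite :: "coord \<times> bool \<times> bool \<Rightarrow> coord \<times> bool \<times> bool" where
  "opposite (k, s, t) = (k, \<not> s, \<not> t)"

text \<open>The labels at raw inner product \<open>golden\<close>. Flipping the unit coordinate
  gives -1 + golden^2 = golden; each of the other four shares one nonzero position with the given
  vertex, where the signs agree.\<close>

fun neighbours :: "coord \<times> bool \<times> bool \<Rightarrow> (coord \<times> bool \<times> bool) list" where
  "neighbours (k, s, t) = [(k, \<not> s, t), (next_coord k, t, True), (next_coord k, t, False),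
     (next_coord (next_coord k), True, s), (next_coord (next_coord k), False, s)]"

abbreviation adj :: "coord \<times> bool \<times> bool \<Rightarrow> coord \<times> bool \<times> bool \<Rightarrow> bool" where
  "adj x y \<equiv> y \<in> set (neighbours x)"

text \<open>The list contains each triangle twice, once for either order of \<open>p\<close> and
  \<open>q\<close>; only its underlying set is counted.\<close>

definition triangles :: "coord \<times> bool \<times> bool \<Rightarrow> (coord \<times> bool \<times> bool) set list" where
  "triangles x = map (\<lambda>(p, q). {x, p, q})
     (filter (\<lambda>(p, q). adj p q) (List.product (neighbours x) (neighbours x)))"

text \<open>An explicit enumeration of all labels, so that statements about the adjacency graph
  become bounded quantifications decided by evaluation.\<close>

definition indices :: "(coord \<times> bool \<times> bool) list" where
  "indices = List.product [X, Y, Z] (List.product [True, False] [True, False])"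

lemma in_indices: "x \<in> set indices"
proof -
  obtain k s t where "x = (k, s, t)" by (metis prod_cases3)
  then show ?thesis by (cases k) (auto simp: indices_def)
qed

lemma distinct_indices: "distinct indices" "length indices = 12"
  by (simp_all add: indices_def)

lemma adj_indices:
  "\<forall>x\<in>set indices. \<forall>y\<in>set indices. adj x y \<longrightarrow> x \<noteq> y \<and> x \<noteq> opposite y \<and> adj y x"
  by code_simp

lemma common_neighbours_indices:
  "\<forall>x\<in>set indices. \<forall>y\<in>set indices. x \<noteq> y \<longrightarrow> x \<noteq> opposite y \<longrightarrow> \<not> adj x y \<longrightarrow>
     (\<exists>p\<in>set (neighbours x). \<exists>q\<in>set (neighbours x). adj p q \<and> adj y p \<and> adj y q)"
  by code_simp

lemma card_triangles_indices: "\<forall>x\<in>set indices. card (set (triangles x)) = 5"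
  by code_simp

lemma adjD: "adj x y \<Longrightarrow> x \<noteq> y \<and> x \<noteq> opposite y \<and> adj y x"
  using adj_indices in_indices by blast

lemma common_neighbours_ex:
  "x \<noteq> y \<Longrightarrow> x \<noteq> opposite y \<Longrightarrow> \<not> adj x y \<Longrightarrow>
     \<exists>p\<in>set (neighbours x). \<exists>q\<in>set (neighbours x). adj p q \<and> adj y p \<and> adj y q"
  using common_neighbours_indices in_indices by blast

lemma card_triangles: "card (set (triangles x)) = 5"
  using card_triangles_indices in_indices by blast

section \<open>From the adjacency graph to inner products\<close>

lemma raw_vertex_inner:
  "raw_vertex x \<bullet> raw_vertex y = (if x = y then golden + 2 else if x = opposite y then - (golden + 2)
     else if adj x y then golden else - golden)"
proof -
  obtain k s t l u v where "x = (k, s, t)" "y = (l, u, v)" by (metis prod_cases3)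
  then show ?thesis
    by (cases k; cases l; cases s; cases t; cases u; cases v;
        simp add: sign_def inner_vec_def sum_3 golden_square)
qed

lemma golden_eq_sqrt5: "golden / (golden + 2) = 1 / sqrt 5"
proof -
  have "golden + 2 = golden * sqrt 5" by (simp add: golden_def field_simps)
  then show ?thesis using golden_gt_1 by simp
qed

lemma vertex_inner:
  "vertex x \<bullet> vertex y = (if x = y then 1 else if x = opposite y then - 1
     else if adj x y then 1 / sqrt 5 else - (1 / sqrt 5))"
proof -
  have "vertex x \<bullet> vertex y = (raw_vertex x \<bullet> raw_vertex y) / (golden + 2)"
    using golden_gt_1 by (simp add: vertex_def)
  moreover have "(- golden - 2) / (golden + 2) = - 1" using golden_gt_1 by (simp add: field_simps)
  ultimately show ?thesis
    using golden_gt_1 by (simp add: raw_vertex_inner golden_eq_sqrt5 del: neighbours.simps)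
qed

lemma vertex_opposite: "vertex (opposite x) = - vertex x"
proof -
  obtain k s t where "x = (k, s, t)" by (metis prod_cases3)
  then have "raw_vertex (opposite x) = - raw_vertex x"
    by (cases k) (simp_all add: sign_def vec_eq_iff forall_3)
  then show ?thesis by (simp add: vertex_def)
qed

lemma inverse_sqrt5_neq:
  "1 / sqrt 5 \<noteq> 1" "- (1 / sqrt 5) \<noteq> 1" "1 / sqrt 5 \<noteq> - 1" "1 / sqrt 5 \<noteq> - (1 / sqrt 5)"
proof -
  have "0 < 1 / sqrt 5" "1 / sqrt 5 < 1" by (simp_all add: real_less_rsqrt)
  then show "1 / sqrt 5 \<noteq> 1" "- (1 / sqrt 5) \<noteq> 1" "1 / sqrt 5 \<noteq> - 1" "1 / sqrt 5 \<noteq> - (1 / sqrt 5)"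
    by linarith+
qed

lemma inj_vertex: "inj vertex"
proof (rule injI)
  fix x y assume "vertex x = vertex y"
  then have "vertex x \<bullet> vertex y = 1" using vertex_inner[of x x] by simp
  then show "x = y"
    using inverse_sqrt5_neq vertex_inner[of x y] by (simp split: if_splits)
qed

lemma vertex_inner_eq_iff_adj: "vertex x \<bullet> vertex y = 1 / sqrt 5 \<longleftrightarrow> adj x y"
proof (cases "x = y \<or> x = opposite y")
  case True
  then have "\<not> adj x y" using adjD by blast
  with True show ?thesis
    using inverse_sqrt5_neq unfolding vertex_inner by (auto simp del: neighbours.simps split: if_splits)
next
  case False
  then show ?thesis using inverse_sqrt5_neq unfolding vertex_inner by (simp del: neighbours.simps)
qed

lemma card_vertices: "card vertices = 12"
proof -
  have "card vertices = card (UNIV :: (coord \<times> bool \<times> bool) set)"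
    unfolding vertices_def by (rule card_image[OF inj_vertex])
  also have "UNIV = set indices" using in_indices by blast
  finally show ?thesis using distinct_card[OF distinct_indices(1)] distinct_indices(2) by simp
qed

text \<open>Under the injection \<open>vertex\<close>, inner product 1/sqrt 5 means adjacency, so
  the equiangular triples through a vertex are its pairs of adjacent neighbours. This reduces
  \<open>five_triangles\<close> to the finite count \<open>card_triangles\<close>.\<close>

lemma triangles_at_vertex:
  "{T. T \<subseteq> vertices \<and> card T = 3 \<and> equiangular T \<and> vertex x \<in> T} = (`) vertex ` set (triangles x)"
    (is "?A = ?B")
proof (intro set_eqI iffI)
  fix T assume "T \<in> ?A"
  then have T: "T \<subseteq> vertices" "card T = 3" "equiangular T" "vertex x \<in> T" by auto
  define S where "S = vertex -` T"
  have TS: "T = vertex ` S" using T(1) by (auto simp: S_def vertices_def)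
  have "card S = 3" using T(2) TS inj_vertex by (simp add: card_image inj_on_subset)
  moreover have xS: "x \<in> S" using T(4) by (simp add: S_def)
  ultimately have "card (S - {x}) = 2" by simp
  then obtain p q where pq: "S - {x} = {p, q}" "p \<noteq> q" unfolding card_2_iff by blast
  then have S: "S = {x, p, q}" "p \<noteq> x" "q \<noteq> x" using xS by blast+
  have adj: "adj i j" if "i \<in> S" "j \<in> S" "i \<noteq> j" for i j
  proof -
    have "vertex i \<noteq> vertex j" "vertex i \<in> T" "vertex j \<in> T"
      using injD[OF inj_vertex, of i j] that by (auto simp: S_def)
    then show ?thesis
      using T(3) unfolding equiangular_def vertex_inner_eq_iff_adj[symmetric] by blast
  qed
  have "adj p q" "adj x p" "adj x q" using S pq(2) by (simp_all add: adj del: neighbours.simps)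
  then have "(p, q) \<in> set (filter (\<lambda>(p, q). adj p q) (List.product (neighbours x) (neighbours x)))"
    by (simp del: neighbours.simps)
  then have "S \<in> set (triangles x)" unfolding triangles_def S(1) set_map by (rule rev_image_eqI) simp
  then show "T \<in> ?B" unfolding TS by (rule imageI)
next
  fix T assume "T \<in> ?B"
  then obtain p q where T: "T = vertex ` {x, p, q}" and pq: "adj p q" "adj x p" "adj x q"
    by (auto simp: triangles_def simp del: neighbours.simps)
  note adj = pq adjD[OF pq(1)] adjD[OF pq(2)] adjD[OF pq(3)]
  have "card T = card {x, p, q}"
    unfolding T by (intro card_image inj_on_subset[OF inj_vertex]) simp
  then have "card T = 3" using adj by simp
  moreover have "equiangular T"
    unfolding equiangular_def T using adj by (simp add: vertex_inner_eq_iff_adj del: neighbours.simps)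
  moreover have "T \<subseteq> vertices" unfolding T vertices_def by (intro image_mono) simp
  moreover have "vertex x \<in> T" by (simp add: T)
  ultimately show "T \<in> ?A" by simp
qed

lemma icosahedral_vertices: "icosahedral vertices"
proof
  show "finite vertices" using card_vertices by (metis card.infinite zero_neq_numeral)
  show "vertices \<noteq> {}" by (simp add: vertices_def)
next
  fix v assume "v \<in> vertices"
  then obtain x where x: "v = vertex x" by (auto simp: vertices_def)
  show "norm v = 1" using vertex_inner[of x x] x by (simp add: norm_eq_1)
  show "- v \<in> vertices" unfolding x vertices_def vertex_opposite[symmetric] by (rule rangeI)
  have "inj_on ((`) vertex) (set (triangles x))"
    using inj_vertex by (simp add: inj_on_def inj_image_eq_iff)
  then show "card {T. T \<subseteq> vertices \<and> card T = 3 \<and> equiangular T \<and> v \<in> T} = 5"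
    by (simp add: x triangles_at_vertex card_image card_triangles)
next
  fix v w assume "v \<in> vertices" "w \<in> vertices"
  then obtain x y where xy: "v = vertex x" "w = vertex y" unfolding vertices_def by blast
  show "v \<bullet> w = 1 / sqrt 5 \<or> v \<bullet> w = - (1 / sqrt 5)" if "v \<noteq> w" "v \<noteq> - w"
  proof -
    have "x \<noteq> y" "x \<noteq> opposite y" using that vertex_opposite[of y] by (auto simp: xy)
    then show ?thesis by (simp add: xy vertex_inner)
  qed
  show "\<exists>p\<in>vertices. \<exists>q\<in>vertices. p \<bullet> q = 1 / sqrt 5 \<and> v \<bullet> p = 1 / sqrt 5 \<and> v \<bullet> q = 1 / sqrt 5 \<and>
        w \<bullet> p = 1 / sqrt 5 \<and> w \<bullet> q = 1 / sqrt 5"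
    if vw: "v \<bullet> w = - (1 / sqrt 5)"
  proof -
    have "x \<noteq> y" "x \<noteq> opposite y" "\<not> adj x y"
      using vw inverse_sqrt5_neq unfolding xy vertex_inner by (simp_all split: if_splits)
    then obtain p q where pq: "adj x p" "adj x q" "adj p q" "adj y p" "adj y q"
      using common_neighbours_ex by blast
    then have "vertex p \<bullet> vertex q = 1 / sqrt 5 \<and> v \<bullet> vertex p = 1 / sqrt 5 \<and> v \<bullet> vertex q = 1 / sqrt 5 \<and>
        w \<bullet> vertex p = 1 / sqrt 5 \<and> w \<bullet> vertex q = 1 / sqrt 5"
      unfolding xy vertex_inner_eq_iff_adj by blast
    then show ?thesis unfolding vertices_def by blast
  qed
qed

section \<open>Zeros of the Jacobian determinant\<close>

text \<open>With one coordinate zero, both values of \<open>L\<close> are multiples of z^2 -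
  golden^2 y^2. Its vanishing and the normalisation fix both squares.\<close>

lemma vertex_coordinates:
  fixes y z :: real
  assumes "y\<^sup>2 * (L (y\<^sup>2) (z\<^sup>2) 0)\<^sup>2 = 0" "z\<^sup>2 * (L (z\<^sup>2) 0 (y\<^sup>2))\<^sup>2 = 0" "y\<^sup>2 + z\<^sup>2 = 1"
  obtains s t where "s \<in> {1, - 1}" "t \<in> {golden, - golden}"
    "y = s / sqrt (golden + 2)" "z = t / sqrt (golden + 2)"
proof -
  have g: "golden > 0" using golden_gt_1 by simp
  have "z\<^sup>2 = golden\<^sup>2 * y\<^sup>2"
  proof (cases "y = 0")
    \<comment> \<open>Here the second hypothesis forces \<open>z = 0\<close> as well, against y^2 +
      z^2 = 1.\<close>
    case True
    then show ?thesis using assms g by (auto simp: L_def)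
  next
    case False
    then show ?thesis using assms(1) by (simp add: L_def)
  qed
  moreover from this have "y\<^sup>2 * (golden + 2) = 1"
    using assms(3) by (simp add: golden_power_simps algebra_simps)
  then have y: "y\<^sup>2 = 1 / (golden + 2)" using g by (simp add: field_simps)
  ultimately have "z\<^sup>2 = golden\<^sup>2 / (golden + 2)" by simp
  then have "z\<^sup>2 = (golden / sqrt (golden + 2))\<^sup>2" "y\<^sup>2 = (1 / sqrt (golden + 2))\<^sup>2"
    using y g by (simp_all add: power_divide)
  then have "y = 1 / sqrt (golden + 2) \<or> y = - 1 / sqrt (golden + 2)"
    "z = golden / sqrt (golden + 2) \<or> z = - golden / sqrt (golden + 2)"
    by (simp_all only: power2_eq_iff minus_divide_left)
  then show thesis using that by blast
qed

lemma vertex_eq: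
  assumes "s \<in> {1, - 1}" "t \<in> {golden, - golden}"
  shows "vector [0, s / sqrt (golden + 2), t / sqrt (golden + 2)] \<in> vertices"
    and "vector [t / sqrt (golden + 2), 0, s / sqrt (golden + 2)] \<in> vertices"
    and "vector [s / sqrt (golden + 2), t / sqrt (golden + 2), 0] \<in> vertices"
proof -
  \<comment> \<open>The Boolean labels are read off the signs; \<open>t = golden\<close> tests
    positivity because \<open>golden\<close> differs from its negative.\<close>
  have st: "sign (s = 1) = s" "golden * sign (t = golden) = t"
    using assms golden_gt_1 by (auto simp: sign_def)
  have "vector [0, s / sqrt (golden + 2), t / sqrt (golden + 2)] = vertex (X, s = 1, t = golden)"
    "vector [t / sqrt (golden + 2), 0, s / sqrt (golden + 2)] = vertex (Y, s = 1, t = golden)"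
    "vector [s / sqrt (golden + 2), t / sqrt (golden + 2), 0] = vertex (Z, s = 1, t = golden)"
    by (simp_all add: vertex_def vec_eq_iff forall_3 st)
  then show "vector [0, s / sqrt (golden + 2), t / sqrt (golden + 2)] \<in> vertices"
    "vector [t / sqrt (golden + 2), 0, s / sqrt (golden + 2)] \<in> vertices"
    "vector [s / sqrt (golden + 2), t / sqrt (golden + 2), 0] \<in> vertices"
    by (simp_all add: vertices_def)
qed

lemma jacobian_det_Qmap_nonneg: "0 \<le> jacobian_det Qmap x"
proof -
  have "0 \<le> golden * jacobian_det Qmap x"
    using golden_gt_1 unfolding jacobian_det_Qmap by (intro add_nonneg_nonneg mult_nonneg_nonneg) auto
  then show ?thesis using golden_gt_1 by (simp add: zero_le_mult_iff)
qed

lemma jacobian_det_Qmap_vertex: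
  assumes "v \<in> vertices"
  shows "jacobian_det Qmap v = 0"
proof -
  obtain k s t where v: "v = vertex (k, s, t)" using assms by (auto simp: vertices_def)
  have "(sign u)\<^sup>2 = 1" for u by (simp add: sign_def)
  then have "golden * jacobian_det Qmap v = 0"
    unfolding jacobian_det_Qmap v using golden_gt_1
    by (cases k) (simp_all add: vertex_def L_def power_divide power_mult_distrib)
  then show ?thesis using golden_gt_1 by simp
qed

text \<open>All four nonnegative terms vanish, and the product term makes some coordinate zero. The
  cyclic symmetry then reduces each case to \<open>vertex_coordinates\<close>.\<close>

lemma jacobian_det_Qmap_zero:
  assumes "norm x = 1" "jacobian_det Qmap x = 0"
  shows "x \<in> vertices"
proof -
  obtain a b c where abc: "a = x $ 1" "b = x $ 2" "c = x $ 3" by blast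
  have "a\<^sup>2 * (L (a\<^sup>2) (b\<^sup>2) (c\<^sup>2))\<^sup>2 + b\<^sup>2 * (L (b\<^sup>2) (c\<^sup>2) (a\<^sup>2))\<^sup>2
      + c\<^sup>2 * (L (c\<^sup>2) (a\<^sup>2) (b\<^sup>2))\<^sup>2 + 20 * golden ^ 4 * a\<^sup>2 * b\<^sup>2 * c\<^sup>2 = 0"
    using jacobian_det_Qmap[of x] assms(2) by (simp add: abc)
  moreover have "0 \<le> a\<^sup>2 * (L (a\<^sup>2) (b\<^sup>2) (c\<^sup>2))\<^sup>2" "0 \<le> b\<^sup>2 * (L (b\<^sup>2) (c\<^sup>2) (a\<^sup>2))\<^sup>2"
      "0 \<le> c\<^sup>2 * (L (c\<^sup>2) (a\<^sup>2) (b\<^sup>2))\<^sup>2" "0 \<le> 20 * golden ^ 4 * a\<^sup>2 * b\<^sup>2 * c\<^sup>2"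
    using golden_gt_1 by simp_all
  ultimately have z: "a\<^sup>2 * (L (a\<^sup>2) (b\<^sup>2) (c\<^sup>2))\<^sup>2 = 0" "b\<^sup>2 * (L (b\<^sup>2) (c\<^sup>2) (a\<^sup>2))\<^sup>2 = 0"
      "c\<^sup>2 * (L (c\<^sup>2) (a\<^sup>2) (b\<^sup>2))\<^sup>2 = 0" "20 * golden ^ 4 * a\<^sup>2 * b\<^sup>2 * c\<^sup>2 = 0"
    by linarith+
  have x: "x = vector [a, b, c]" by (simp add: abc vec_eq_iff forall_3)
  have "x \<bullet> x = 1" using assms(1) by (simp add: norm_eq_1)
  then have n: "a\<^sup>2 + b\<^sup>2 + c\<^sup>2 = 1" by (simp add: abc inner_vec_def sum_3 power2_eq_square)
  consider "a = 0" | "b = 0" | "c = 0" using z(4) golden_gt_1 by auto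
  then show ?thesis
  proof cases
    case 1
    obtain s t where "s \<in> {1, - 1}" "t \<in> {golden, - golden}"
      "b = s / sqrt (golden + 2)" "c = t / sqrt (golden + 2)"
      by (rule vertex_coordinates[of b c]) (use z n 1 in auto)
    then show ?thesis using vertex_eq(1) 1 by (simp only: x)
  next
    case 2
    obtain s t where "s \<in> {1, - 1}" "t \<in> {golden, - golden}"
      "c = s / sqrt (golden + 2)" "a = t / sqrt (golden + 2)"
      by (rule vertex_coordinates[of c a]) (use z n 2 in auto)
    then show ?thesis using vertex_eq(2) 2 by (simp only: x)
  next
    case 3
    obtain s t where "s \<in> {1, - 1}" "t \<in> {golden, - golden}"
      "a = s / sqrt (golden + 2)" "b = t / sqrt (golden + 2)"
      by (rule vertex_coordinates[of a b]) (use z n 3 in auto)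
    then show ?thesis using vertex_eq(3) 3 by (simp only: x)
  qed
qed

lemma jacobian_det_Qmap_axis: "jacobian_det Qmap (axis 1 1) \<noteq> 0"
proof -
  have "golden * jacobian_det Qmap (axis 1 1) \<noteq> 0"
    unfolding jacobian_det_Qmap using golden_gt_1 by (simp add: axis_def L_def)
  then show ?thesis by auto
qed

lemma not_quasiregular_Qmap: "\<not> quasiregular UNIV Qmap"
proof
  assume "quasiregular UNIV Qmap"
  then obtain K where K: "\<And>x e. norm e = 1 \<Longrightarrow>
      norm (jacobian Qmap (at x) *v e) ^ CARD(3) \<le> K * jacobian_det Qmap x"
    using quasiregular_imp_jacobian_bound[OF _ C_k_Qmap] by blast
  \<comment> \<open>The vertex is a multiple of (0, 1, golden). Since the determinant vanishes
    there, the bound forces the second column of the Jacobian matrix to be zero.\<close>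
  let ?J = "jacobian Qmap (at (vertex (X, True, True)))"
  have "jacobian_det Qmap (vertex (X, True, True)) = 0"
    by (rule jacobian_det_Qmap_vertex) (simp add: vertices_def)
  then have "norm (?J *v axis 2 1) ^ CARD(3) \<le> 0" using K[of "axis 2 1" "vertex (X, True, True)"] by simp
  then have "?J *v axis 2 1 = 0" by simp
  then have "?J $ 2 $ 2 = 0" by (simp add: matrix_vector_mult_basis column_def vec_eq_iff)
  moreover have "vertex (X, True, True) $ 1 = 0" "(vertex (X, True, True) $ 2)\<^sup>2 = 1 / (golden + 2)"
      "(vertex (X, True, True) $ 3)\<^sup>2 = golden\<^sup>2 / (golden + 2)"
    using golden_gt_1 by (simp_all add: vertex_def sign_def power_divide)
  \<comment> \<open>The left side is the diagonal entry in row 2; its numerator golden^4 - golden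
    equals 2 golden + 2, which is positive.\<close>
  ultimately have "(golden\<^sup>2 * golden\<^sup>2 - golden) / (golden + 2) = 0"
    by (simp add: jacobian_Qmap dQ1_def axis_def diff_divide_distrib)
  then have "golden\<^sup>2 * golden\<^sup>2 - golden = 0" using golden_gt_1 by simp
  then have "2 * golden + 2 = 0" by (simp add: golden_power_simps algebra_simps golden_square)
  then show False using golden_gt_1 by simp
qed

theorem theorem1p4:
  shows "\<exists>Q :: real^3 \<Rightarrow> real^3.
    homogeneous_harmonic_cubic Q \<and>
    (\<forall>x. jacobian_det Q x \<ge> 0) \<and>
    (\<exists>x. jacobian_det Q x \<noteq> 0) \<and>
    (\<exists>P. regular_icosahedron P \<and>
         card {v. v extreme_point_of P} = 12 \<and>
         {x \<in> sphere 0 1. jacobian_det Q x = 0} = {v. v extreme_point_of P}) \<and>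
    \<not> quasiregular UNIV Q"
proof (rule exI[of _ Qmap], intro conjI)
  interpret icosahedral vertices by (rule icosahedral_vertices)
  show "homogeneous_harmonic_cubic Qmap" by (rule homogeneous_harmonic_cubic_Qmap)
  show "\<forall>x. 0 \<le> jacobian_det Qmap x" by (simp add: jacobian_det_Qmap_nonneg)
  show "\<exists>x. jacobian_det Qmap x \<noteq> 0" using jacobian_det_Qmap_axis by (rule exI)
  show "\<exists>P. regular_icosahedron P \<and> card {v. v extreme_point_of P} = 12 \<and>
      {x \<in> sphere 0 1. jacobian_det Qmap x = 0} = {v. v extreme_point_of P}"
  proof (rule exI[of _ "convex hull vertices"], intro conjI)
    show "regular_icosahedron (convex hull vertices)" by (rule regular_icosahedron_hull)
    show "card {v. v extreme_point_of convex hull vertices} = 12"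
      by (simp add: extreme_point_iff card_vertices)
    show "{x \<in> sphere 0 1. jacobian_det Qmap x = 0} = {v. v extreme_point_of convex hull vertices}"
      using jacobian_det_Qmap_zero jacobian_det_Qmap_vertex norm by (auto simp: extreme_point_iff)
  qed
  show "\<not> quasiregular UNIV Qmap" by (rule not_quasiregular_Qmap)
qed

end
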